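(* Let $n\ge2$. There exist automorphisms $\lambda_u$ of $\mathcal O_n$, with $u\in\mathcal S_n$, such that for all $w\in\mathcal U(\mathcal O_n)$ and all $v\in\mathcal U(\mathcal F_n)$ we have $\lambda_u\ne\operatorname{Ad}(w)\lambda_v$.
   Context: $\mathcal O_n$ is the Cuntz algebra, the $C^*$-algebra generated by isometries $S_1,\dots,S_n$ with $\sum_{i=1}^n S_iS_i^*=1$. For a word $\mu=(\mu_1,\dots,\mu_k)$ in the letters $1,\dots,n$ put $S_\mu=S_{\mu_1}\cdots S_{\mu_k}$ ($=1$ for the empty word). $\mathcal F_n$ is the core UHF-subalgebra: the closed linear span of all $S_\mu S_\nu^*$ with $\mu,\nu$ words of equal length. $\mathcal U(A)$ is the unitary group of $A$. $\mathcal S_n$ is the group of unitaries in $\mathcal O_n$ that are finite sums of elements of the form $S_\alpha S_\beta^*$ ($\alpha,\beta$ words). For $u\in\mathcal U(\mathcal O_n)$, $\lambda_u$ is the unital $*$-endomorphism of $\mathcal O_n$ with $\lambda_u(S_i)=uS_i$ for $i=1,\dots,n$. $\operatorname{Ad}(w)(x)=wxw^*$, and $\operatorname{Ad}(w)\lambda_v$ is the composition $\operatorname{Ad}(w)\circ\lambda_v$. *)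

theory Defs
  imports "HOL-Analysis.Analysis"
begin

text \<open>
  Unital, nonzero complex C*-algebras. The class \<open>real_normed_algebra_1\<close> supplies
  \<open>norm (x * y) \<le> norm x * norm y\<close> and \<open>norm 1 = 1\<close>; the latter excludes the zero algebra.
\<close>

class cstar_algebra = real_normed_algebra_1 + banach +
  fixes scaleC :: "complex \<Rightarrow> 'a \<Rightarrow> 'a" (infixr \<open>*\<^sub>C\<close> 75)
    and star :: "'a \<Rightarrow> 'a"
  assumes scaleC_add_right: "c *\<^sub>C (x + y) = c *\<^sub>C x + c *\<^sub>C y"
    and scaleC_add_left: "(c + d) *\<^sub>C x = c *\<^sub>C x + d *\<^sub>C x"
    and scaleC_scaleC: "c *\<^sub>C (d *\<^sub>C x) = (c * d) *\<^sub>C x"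
    and scaleC_of_real: "complex_of_real r *\<^sub>C x = r *\<^sub>R x"
    and scaleC_mult_left: "(c *\<^sub>C x) * y = c *\<^sub>C (x * y)"
    and scaleC_mult_right: "x * (c *\<^sub>C y) = c *\<^sub>C (x * y)"
    and norm_scaleC: "norm (c *\<^sub>C x) = cmod c * norm x"
    and star_star: "star (star x) = x"
    and star_add: "star (x + y) = star x + star y"
    and star_scaleC: "star (c *\<^sub>C x) = cnj c *\<^sub>C star x"
    and star_mult: "star (x * y) = star y * star x"
    and cstar_identity: "norm (star x * x) = (norm x)\<^sup>2"

interpretation complex_vs: vector_space "scaleC :: complex \<Rightarrow> 'a \<Rightarrow> 'a::cstar_algebra"
proof
  show "1 *\<^sub>C x = x" for x :: 'a
    using scaleC_of_real[of 1 x] by simp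
qed (simp_all add: scaleC_add_right scaleC_add_left scaleC_scaleC)

definition unitaries :: "'a::cstar_algebra set" where
  "unitaries = {u. star u * u = 1 \<and> u * star u = 1}"

definition cstar_subalgebra :: "'a::cstar_algebra set \<Rightarrow> bool" where
  "cstar_subalgebra B \<longleftrightarrow>
     complex_vs.subspace B \<and> closed B \<and>
     (\<forall>x\<in>B. \<forall>y\<in>B. x * y \<in> B) \<and> (\<forall>x\<in>B. star x \<in> B)"

definition cstar_generated :: "'a::cstar_algebra set \<Rightarrow> 'a set" where
  "cstar_generated X = \<Inter>{B. cstar_subalgebra B \<and> X \<subseteq> B}"

text \<open>
  \<open>is_cuntz_algebra n S\<close>: the whole C*-algebra \<open>'a\<close> is a copy of the Cuntz algebra, with
  \<open>S 1, \<dots>, S n\<close> as its generating isometries. Values of \<open>S\<close> outside \<open>{1..n}\<close> are irrelevant.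
\<close>

definition is_cuntz_algebra :: "nat \<Rightarrow> (nat \<Rightarrow> 'a::cstar_algebra) \<Rightarrow> bool" where
  "is_cuntz_algebra n S \<longleftrightarrow>
     (\<forall>i\<in>{1..n}. star (S i) * S i = 1) \<and>
     (\<Sum>i=1..n. S i * star (S i)) = 1 \<and>
     cstar_generated (S ` {1..n}) = UNIV"

definition words :: "nat \<Rightarrow> nat list set" where
  "words n = {\<mu>. set \<mu> \<subseteq> {1..n}}"

definition word_elem :: "(nat \<Rightarrow> 'a::cstar_algebra) \<Rightarrow> nat list \<Rightarrow> 'a" where
  "word_elem S \<mu> = prod_list (map S \<mu>)"

definition cuntz_core :: "nat \<Rightarrow> (nat \<Rightarrow> 'a::cstar_algebra) \<Rightarrow> 'a set" where
  "cuntz_core n S =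
     closure (complex_vs.span
       {word_elem S \<mu> * star (word_elem S \<nu>) | \<mu> \<nu>.
          \<mu> \<in> words n \<and> \<nu> \<in> words n \<and> length \<mu> = length \<nu>})"

definition cuntz_sum_unitaries :: "nat \<Rightarrow> (nat \<Rightarrow> 'a::cstar_algebra) \<Rightarrow> 'a set" where
  "cuntz_sum_unitaries n S =
     {u \<in> unitaries. \<exists>ps. set ps \<subseteq> words n \<times> words n \<and>
        u = (\<Sum>(\<alpha>, \<beta>)\<leftarrow>ps. word_elem S \<alpha> * star (word_elem S \<beta>))}"

definition unital_star_endo :: "('a::cstar_algebra \<Rightarrow> 'a) \<Rightarrow> bool" where
  "unital_star_endo \<phi> \<longleftrightarrow>
     (\<forall>x y. \<phi> (x + y) = \<phi> x + \<phi> y) \<and>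
     (\<forall>c x. \<phi> (c *\<^sub>C x) = c *\<^sub>C \<phi> x) \<and>
     (\<forall>x y. \<phi> (x * y) = \<phi> x * \<phi> y) \<and>
     (\<forall>x. \<phi> (star x) = star (\<phi> x)) \<and>
     \<phi> 1 = 1"

text \<open>
  \<open>is_cuntz_endo n S u \<phi>\<close> says that \<open>\<phi>\<close> is \<open>\<lambda>\<^sub>u\<close>. In a Cuntz algebra with \<open>n \<ge> 2\<close> exactly one
  \<open>\<phi>\<close> satisfies this for each unitary \<open>u\<close> (Cuntz); a relation is used so that
  no statement about \<open>\<lambda>\<^sub>u\<close> involves an unspecified value.
\<close>

definition is_cuntz_endo ::
  "nat \<Rightarrow> (nat \<Rightarrow> 'a::cstar_algebra) \<Rightarrow> 'a \<Rightarrow> ('a \<Rightarrow> 'a) \<Rightarrow> bool" where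
  "is_cuntz_endo n S u \<phi> \<longleftrightarrow>
     unital_star_endo \<phi> \<and> (\<forall>i\<in>{1..n}. \<phi> (S i) = u * S i)"

definition Ad :: "'a::cstar_algebra \<Rightarrow> 'a \<Rightarrow> 'a" where
  "Ad w x = w * x * star w"

end

theory Submission
  imports Defs
begin

text \<open>
  Take \<open>u\<close> such that \<open>\<lambda>\<^sub>u\<close> fixes all generators except \<open>S 2\<close>, which is sent to \<open>S 2 * swap\<close> with
  \<open>swap\<close> the self-adjoint unitary that exchanges the prefixes 2 and 12. As \<open>\<lambda>\<^sub>u\<close> fixes \<open>swap\<close>, it
  is an involution. It sends \<open>S 2 ^ k\<close> to \<open>w \<alpha> * swap\<close>, where \<open>w \<alpha>\<close> is the product of the generators
  along a word \<open>\<alpha>\<close> of length \<open>2 * k - 1\<close>. If \<open>\<lambda>\<^sub>u\<close> were \<open>Ad(z)\<lambda>\<^sub>v\<close> with \<open>v\<close> in the core, then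
  \<open>swap * z = star (w \<alpha>) * z * (v * S 2) ^ k\<close> would, for large \<open>k\<close>, be a unitary close to an
  element all of whose homogeneous components have negative degree. The KMS condition of the
  canonical state forbids this.

  The existence of \<open>\<lambda>\<^sub>u\<close> needs no spectral theory. On the *-algebra of polynomials in the
  generators, the projections to the homogeneous components are contractive, being essentially
  compressions by isometries of the algebra; this gives for \<open>\<lambda>\<^sub>u\<close> a norm bound that grows linearly
  in the degree, and the C*-identity applied to high powers improves it to a contraction.
\<close>

section \<open>Self-adjoint elements of C*-algebras\<close>

lemma scaleR_eq_scaleC: "r *\<^sub>R (x::'a::cstar_algebra) = complex_of_real r *\<^sub>C x"
  by (simp add: scaleC_of_real)

lemma scaleC_one: "1 *\<^sub>C (x::'a::cstar_algebra) = x"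
  using scaleC_of_real[of 1 x] by simp

lemma star_scaleR: "star (r *\<^sub>R x) = r *\<^sub>R star (x::'a::cstar_algebra)"
  by (simp add: scaleR_eq_scaleC star_scaleC)

lemma star_zero: "star (0::'a::cstar_algebra) = 0"
  using star_add[of "0::'a" 0] by simp

lemma star_minus: "star (- x) = - star (x::'a::cstar_algebra)"
  using star_scaleR[of "-1" x] by simp

lemma star_diff: "star (x - y) = star x - star (y::'a::cstar_algebra)"
  using star_add[of x "- y"] by (simp add: star_minus)

lemma star_one: "star (1::'a::cstar_algebra) = 1"
  using star_mult[of "star (1::'a)" 1] by (simp add: star_star)

lemma star_sum: "star (\<Sum>i\<in>A. f i) = (\<Sum>i\<in>A. star (f i :: 'a::cstar_algebra))"
  by (induction A rule: infinite_finite_induct) (auto simp: star_zero star_add)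

lemma star_power: "star (x ^ k) = star (x::'a::cstar_algebra) ^ k"
  by (induction k) (auto simp: star_one star_mult power_commutes)

lemmas star_simps = star_zero star_one star_add star_diff star_minus star_mult star_star
  star_scaleR star_scaleC star_sum

lemma norm_star: "norm (star x) = norm (x::'a::cstar_algebra)"
proof -
  have "norm y \<le> norm (star y)" for y :: 'a
  proof (cases "y = 0")
    case False
    have "norm y * norm y \<le> norm (star y) * norm y"
      using norm_mult_ineq[of "star y" y] by (simp add: cstar_identity power2_eq_square)
    then show ?thesis using False by simp
  qed simp
  from this[of x] this[of "star x"] show ?thesis by (simp add: star_star)
qed

lemma bounded_linear_star: "bounded_linear (star :: 'a::cstar_algebra \<Rightarrow> 'a)"
  by (rule bounded_linear_intro[where K = 1]) (simp_all add: star_simps norm_star)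

lemma bounded_linear_scaleC: "bounded_linear (\<lambda>x::'a::cstar_algebra. c *\<^sub>C x)"
proof (rule bounded_linear_intro[where K = "cmod c"])
  show "c *\<^sub>C (r *\<^sub>R x) = r *\<^sub>R (c *\<^sub>C x)" for r and x :: 'a
    by (simp add: scaleR_eq_scaleC scaleC_scaleC mult.commute)
qed (simp_all add: scaleC_add_right norm_scaleC mult.commute)

lemma norm_isometry:
  assumes "star v * v = (1::'a::cstar_algebra)"
  shows "norm v = 1"
proof -
  have "(norm v)\<^sup>2 = 1" using cstar_identity[of v] assms by simp
  then show ?thesis using norm_ge_zero[of v] unfolding power2_eq_1_iff by linarith
qed

lemma norm_isometry_conj_le:
  assumes "star v * v = (1::'a::cstar_algebra)"
  shows "norm (star v * x * v) \<le> norm x"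
proof -
  have "norm (star v * x * v) \<le> norm (star v) * norm x * norm v"
    by (meson mult_right_mono norm_ge_zero norm_mult_ineq order_trans)
  then show ?thesis by (simp add: norm_star norm_isometry[OF assms])
qed

text \<open>For commuting self-adjoint elements, \<open>x * x + y * y\<close> is
  \<open>star z * z\<close> with z = x + i y, and \<open>x\<close> is the real part of z. This
  replaces the monotonicity of the norm on positive elements.\<close>

lemma norm_self_adjoint_sum_squares:
  fixes x y :: "'a::cstar_algebra"
  assumes "star x = x" "star y = y" "x * y = y * x"
  shows "(norm x)\<^sup>2 \<le> norm (x * x + y * y)"
proof -
  let ?z = "x + \<i> *\<^sub>C y"
  have sz: "star ?z = x - \<i> *\<^sub>C y"
    using assms by (simp add: star_simps flip: complex_vs.scale_minus_left)
  have "star ?z * ?z = x * x + y * y"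
    using assms
    by (simp add: sz algebra_simps scaleC_mult_left scaleC_mult_right scaleC_scaleC
        flip: complex_vs.scale_minus_left) (simp add: scaleC_one)
  then have z: "(norm ?z)\<^sup>2 = norm (x * x + y * y)"
    using cstar_identity[of ?z] by simp
  have "2 *\<^sub>R x = ?z + star ?z" by (simp add: sz scaleR_2)
  then have "2 * norm x \<le> norm ?z + norm (star ?z)"
    by (metis abs_numeral norm_scaleR norm_triangle_ineq)
  then have "norm x \<le> norm ?z" by (simp add: norm_star)
  then show ?thesis using z by (metis norm_ge_zero power_mono)
qed

lemma star_exp: "star (exp x) = exp (star (x::'a::cstar_algebra))"
proof -
  have "(\<lambda>k. star (x ^ k /\<^sub>R fact k)) sums star (exp x)"
    using bounded_linear.sums[OF bounded_linear_star exp_converges[of x]] by simp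
  then have "(\<lambda>k. star x ^ k /\<^sub>R fact k) sums star (exp x)"
    by (simp add: star_simps star_power)
  then show ?thesis using exp_converges sums_unique2 by blast
qed

text \<open>The identity (2 h)^2 + (1 - h^2)^2 = (1 + h^2)^2 brings 2 h under
  \<open>norm_self_adjoint_sum_squares\<close>. Positivity of squares would even give h = 0; the
  weak bound is enough for \<open>unit_extreme_self_adjoint\<close>.\<close>

lemma self_adjoint_bound:
  fixes h :: "'a::cstar_algebra"
  assumes "star h = h" "norm (1 + h * h) \<le> 1"
  shows "norm h \<le> 1 / 2"
proof -
  have "(norm (2 *\<^sub>R h))\<^sup>2 \<le> norm ((2 *\<^sub>R h) * (2 *\<^sub>R h) + (1 - h * h) * (1 - h * h))"
    by (rule norm_self_adjoint_sum_squares) (use assms in \<open>simp_all add: star_simps algebra_simps\<close>)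
  also have "(2 *\<^sub>R h) * (2 *\<^sub>R h) + (1 - h * h) * (1 - h * h) = (1 + h * h) * (1 + h * h)"
    by (simp add: algebra_simps scaleR_2 flip: scaleR_add_left)
  also have "norm \<dots> \<le> 1"
    using assms(2) by (meson mult_le_one norm_ge_zero norm_mult_ineq order_trans)
  finally have "(2 * norm h)\<^sup>2 \<le> 1" by simp
  then have "2 * norm h \<le> 1" using abs_le_square_iff[of "2 * norm h" 1] by simp
  then show ?thesis by simp
qed

text \<open>Factoring out a scalar, exp (t h) = exp (-t) exp (t (1 + h)), and the second factor has
  norm at most exp t.\<close>

lemma norm_exp_le_1:
  fixes h :: "'a::cstar_algebra"
  assumes "norm (1 + h) \<le> 1" "t \<ge> 0"
  shows "norm (exp (t *\<^sub>R h)) \<le> 1"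
proof -
  have "exp (t *\<^sub>R (1 + h)) = exp (t *\<^sub>R 1) * exp (t *\<^sub>R h)"
    by (subst exp_add_commuting[symmetric]) (simp_all add: scaleR_right_distrib)
  moreover have "exp (t *\<^sub>R 1) = (of_real (exp t) :: 'a)"
    using exp_of_real[of t, where 'a = 'a] by (simp only: of_real_def)
  ultimately have "exp (t *\<^sub>R h) = exp (- t) *\<^sub>R exp (t *\<^sub>R (1 + h))"
    by (simp add: scaleR_conv_of_real[symmetric] exp_minus_inverse mult_exp_exp)
  then have "norm (exp (t *\<^sub>R h)) \<le> exp (- t) * exp (norm (t *\<^sub>R (1 + h)))"
    using norm_exp[of "t *\<^sub>R (1 + h)"] by simp
  also have "\<dots> \<le> exp (- t) * exp t"
    using assms by (simp add: mult_left_le)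
  finally show ?thesis by (simp add: mult_exp_exp)
qed

text \<open>The multiplicative group of the \<open>exp (t *\<^sub>R h)\<close> turns out to lie in a ball of radius less
  than 1 around the unit, and squaring then contracts it to the unit.\<close>

lemma unit_extreme_self_adjoint:
  fixes h :: "'a::cstar_algebra"
  assumes sa: "star h = h" and 1: "norm (1 + h) \<le> 1" and 2: "norm (1 - h) \<le> 1"
  shows "h = 0"
proof -
  define e where "e t = exp (t *\<^sub>R h)" for t :: real
  have e_add: "e (s + t) = e s * e t" for s t
    unfolding e_def scaleR_add_left by (rule exp_add_commuting) simp
  have e0: "e 0 = 1" by (simp add: e_def)
  have e_star: "star (e t) = e t" for t
    by (simp add: e_def star_exp star_scaleR sa)
  have e_le: "norm (e t) \<le> 1" for t
  proof (cases "t \<ge> 0")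
    case True then show ?thesis using norm_exp_le_1[OF 1] by (simp add: e_def)
  next
    case False then show ?thesis using norm_exp_le_1[of "- h" "- t"] 2 by (simp add: e_def)
  qed
  \<comment> \<open>Here \<open>e t - e (- t)\<close> is 2 sinh (t h), and the second fact is the
    double angle formula for cosh.\<close>
  have sinh_le: "norm (e t - e (- t)) \<le> 3 / 4" 
    and cosh_eq: "e (2 * t) + e (- 2 * t) = 2 + (e t - e (- t)) * (e t - e (- t))" for t
  proof -
    have ee: "e t * e t = e (2 * t)" "e (-t) * e (-t) = e (- 2 * t)" 
      "e t * e (- t) = 1" "e (- t) * e t = 1"
      by (simp_all add: e_add[symmetric] e0)
    then show c: "e (2 * t) + e (- 2 * t) = 2 + (e t - e (- t)) * (e t - e (- t))"
      by (simp add: algebra_simps)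
    \<comment> \<open>The factor 1 / sqrt 2 makes \<open>1 + ?k * ?k\<close> equal to cosh (2 t h),
      which has norm at most 1 by \<open>e_le\<close>.\<close>
    let ?k = "(1 / sqrt 2) *\<^sub>R (e t - e (- t))"
    have "1 + ?k * ?k = (1/2) *\<^sub>R (2 + (e t - e (- t)) * (e t - e (- t)))"
      using scaleR_half_double[of "1::'a"] by (simp add: scaleR_add_right)
    also have "norm \<dots> \<le> 1"
      using norm_triangle_ineq[of "e (2 * t)" "e (- 2 * t)"] e_le[of "2 * t"] e_le[of "- 2 * t"] 
      by (simp flip: c)
    finally have "norm ?k \<le> 1 / 2"
      by (rule self_adjoint_bound[rotated]) (simp add: star_simps e_star)
    then have "norm (e t - e (- t)) \<le> sqrt 2 / 2"
      unfolding norm_scaleR by (simp add: field_simps)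
    also have "\<dots> \<le> 3 / 4" using real_le_lsqrt[of "3 / 2" 2] by (simp add: power2_eq_square)
    finally show "norm (e t - e (- t)) \<le> 3 / 4" .
  qed
  \<comment> \<open>Base: 2 (e t - 1) is the square of 2 sinh (t h / 2) plus 2 sinh (t h), of norm
    at most 9/16 + 3/4 < 4/3. Step: a = e t - 1 satisfies 2 a = (e (2 t) - 1) - a^2, and the bound
    2/3 for one factor of a^2 leaves the ratio (1 + 2/3) / 2 = 5/6.\<close>
  have small: "norm (e t - 1) \<le> (5 / 6) ^ k * (2 / 3)" for k t
  proof (induction k arbitrary: t)
    case 0
    let ?D = "\<lambda>t. e t - e (- t)"
    have "2 *\<^sub>R (e t - 1) = (e t + e (- t) - 2) + ?D t"
      by (simp add: scaleR_2)
    also have "e t + e (- t) - 2 = ?D (t / 2) * ?D (t / 2)"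
      using cosh_eq[of "t / 2"] by simp
    finally have "norm (2 *\<^sub>R (e t - 1)) \<le> norm (?D (t / 2)) * norm (?D (t / 2)) + norm (?D t)"
      by (simp only:) (intro norm_triangle_mono norm_mult_ineq order_refl)
    also have "\<dots> \<le> 3 / 4 * (3 / 4) + 3 / 4"
      using sinh_le by (intro add_mono mult_mono) auto
    finally show ?case by simp
  next
    case (Suc k)
    let ?A = "(5 / 6) ^ k * (2 / 3 :: real)" and ?a = "e t - 1"
    have A: "?A \<le> 2 / 3" by (simp add: power_le_one)
    have "2 *\<^sub>R ?a = (e (2 * t) - 1) - ?a * ?a"
      using e_add[of t t] by (simp add: algebra_simps scaleR_2)
    then have "norm (2 *\<^sub>R ?a) \<le> norm (e (2 * t) - 1) + norm ?a * norm ?a"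
      using norm_triangle_ineq4[of "e (2 * t) - 1" "?a * ?a"] norm_mult_ineq[of ?a ?a] by simp
    also have "\<dots> \<le> ?A + ?A * (2 / 3)"
      by (intro add_mono mult_mono Suc.IH order_trans[OF Suc.IH A]) auto
    finally show ?case by simp
  qed
  have "e t = 1" for t
  proof -
    have "(\<lambda>k. (5 / 6) ^ k * (2 / 3 :: real)) \<longlonglongrightarrow> 0 * (2 / 3)"
      by (intro tendsto_mult LIMSEQ_power_zero tendsto_const) auto
    then have "norm (e t - 1) \<le> 0 * (2 / 3)"
      by (rule LIMSEQ_le_const) (use small in blast)
    then show ?thesis by simp
  qed
  \<comment> \<open>The constant function has derivative 0, whereas exp (t h) has derivative h at t
    = 0.\<close>
  then have "((\<lambda>t. exp (t *\<^sub>R h)) has_vector_derivative 0) (at 0)"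
    by (simp add: e_def)
  moreover have "((\<lambda>t. exp (t *\<^sub>R h)) has_vector_derivative exp (0 *\<^sub>R h) * h) (at 0)"
    by (rule exp_scaleR_has_vector_derivative_right)
  ultimately show ?thesis
    using vector_derivative_unique_at by fastforce
qed

section \<open>Cuntz families of isometries\<close>

locale cuntz_family =
  fixes n :: nat and S :: "nat \<Rightarrow> 'a::cstar_algebra"
  assumes n_ge_2: "n \<ge> 2"
    and isometry: "\<And>i. i \<in> {1..n} \<Longrightarrow> star (S i) * S i = 1"
    and sum_ranges: "(\<Sum>i=1..n. S i * star (S i)) = 1"
begin

text \<open>The compressions \<open>b k\<close> of the range projections sum to 1 and
  \<open>b i = 1\<close>, so those with k \<noteq> i sum to 0. Positivity would finish here; its
  substitute is that the reflections \<open>1 - 2 *\<^sub>R (S k * star (S k))\<close> are unitary,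
  so that their compressions are contractions to which \<open>unit_extreme_self_adjoint\<close> can
  be applied.\<close>

lemma orthogonal:
  assumes i: "i \<in> {1..n}" and j: "j \<in> {1..n}" and "i \<noteq> j"
  shows "star (S j) * S i = 0"
proof -
  define b where "b k = star (S i) * (S k * star (S k)) * S i" for k
  have b_eq: "b k = star (star (S k) * S i) * (star (S k) * S i)" for k
    by (simp add: b_def star_simps mult.assoc)
  have b_sa: "star (b k) = b k" for k by (simp add: b_eq star_simps)
  have "(\<Sum>k=1..n. b k) = star (S i) * (\<Sum>k=1..n. S k * star (S k)) * S i"
    by (simp add: b_def sum_distrib_left sum_distrib_right)
  then have "(\<Sum>k=1..n. b k) = 1"
    using sum_ranges isometry[OF i] by simp
  moreover have bi: "b i = 1"
    using isometry[OF i] by (simp add: b_eq star_simps)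
  moreover have "(\<Sum>k=1..n. b k) = b i + (b j + (\<Sum>k\<in>{1..n} - {i, j}. b k))"
    using assms by (subst sum.remove[of _ i], simp, simp, subst sum.remove[of _ j])
      (auto simp: insert_commute simp flip: Diff_insert)
  ultimately have others: "(\<Sum>k\<in>{1..n} - {i, j}. b k) = - b j"
    by (simp add: add_eq_0_iff)
  have refl: "norm (1 - 2 *\<^sub>R b k) \<le> 1" if k: "k \<in> {1..n}" for k
  proof -
    let ?r = "1 - 2 *\<^sub>R (S k * star (S k))"
    have pp: "S k * star (S k) * (S k * star (S k)) = S k * star (S k)"
      using isometry[OF k] by (metis mult.assoc mult.right_neutral)
    have "star ?r * ?r = 1"
      using pp by (simp add: star_simps algebra_simps flip: scaleR_add_left)
    then have "norm ?r = 1" by (rule norm_isometry)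
    moreover have "star (S i) * ?r * S i = 1 - 2 *\<^sub>R b k"
      using isometry[OF i] by (simp add: b_def algebra_simps)
    ultimately show ?thesis
      using norm_isometry_conj_le[OF isometry[OF i], of ?r] by simp
  qed
  have "b j = 0"
  proof (cases "n = 2")
    case True
    then have "{1..n} - {i, j} = {}" using assms by auto
    with others show ?thesis by (metis neg_equal_0_iff_equal sum.empty)
  next
    case False
    define m where "m = real n - 2"
    have m: "m \<ge> 1" using False n_ge_2 by (simp add: m_def)
    have cm: "real (card ({1..n} - {i, j})) = m"
      using assms n_ge_2 by (simp add: m_def card_Diff_subset)
    \<comment> \<open>This scaling makes \<open>1 + ?h\<close> the average of the \<open>m\<close>
      compressed reflections with k other than \<open>i\<close> and \<open>j\<close>, because those
      \<open>b k\<close> sum to \<open>- b j\<close>.\<close>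
    let ?h = "(2 / m) *\<^sub>R b j"
    have "(\<Sum>k\<in>{1..n} - {i, j}. 1 :: 'a) = m *\<^sub>R 1"
      by (simp only: sum_constant mult_1_right of_real_def[symmetric] of_real_of_nat_eq flip: cm)
    then have "m *\<^sub>R (1 + ?h) = (\<Sum>k\<in>{1..n} - {i, j}. 1 - 2 *\<^sub>R b k)"
      using m unfolding sum_subtractf scaleR_sum_right[symmetric] others
      by (simp add: scaleR_add_right)
    also have "norm \<dots> \<le> m"
      using sum_norm_le[of "{1..n} - {i, j}" "\<lambda>k. 1 - 2 *\<^sub>R b k" "\<lambda>_. 1"] refl cm by simp
    finally have h1: "norm (1 + ?h) \<le> 1" using m by simp
    \<comment> \<open>A convex combination of 1 and the compressed reflection of \<open>j\<close>:
      the weight 1 / m is at most 1, as n = 2 has been split off.\<close>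
    have "1 - ?h = (1 - 1 / m) *\<^sub>R 1 + (1 / m) *\<^sub>R (1 - 2 *\<^sub>R b j)"
      using m by (simp add: algebra_simps)
    also have "norm \<dots> \<le> (1 - 1 / m) * 1 + (1 / m) * 1"
      using m refl[OF j] by (intro norm_triangle_mono) (auto simp: divide_right_mono)
    finally have h2: "norm (1 - ?h) \<le> 1" by simp
    have "?h = 0"
      by (rule unit_extreme_self_adjoint[OF _ h1 h2]) (simp add: star_simps b_sa)
    then show ?thesis using m by auto
  qed
  then show ?thesis
    using cstar_identity[of "star (S j) * S i"] by (simp add: b_eq)
qed

lemma star_mult_gen:
  "i \<in> {1..n} \<Longrightarrow> j \<in> {1..n} \<Longrightarrow> star (S i) * S j = (if i = j then 1 else 0)"
  using isometry orthogonal by auto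

abbreviation w :: "nat list \<Rightarrow> 'a" where "w \<equiv> word_elem S"

definition monom :: "nat list \<Rightarrow> nat list \<Rightarrow> 'a" where
  "monom \<mu> \<nu> = w \<mu> * star (w \<nu>)"

end

section \<open>Words and monomials in the generators\<close>

definition words_of :: "nat \<Rightarrow> nat \<Rightarrow> nat list set" where
  "words_of n k = {\<mu>. set \<mu> \<subseteq> {1..n} \<and> length \<mu> = k}"

lemma words_of_iff: "\<mu> \<in> words_of n k \<longleftrightarrow> \<mu> \<in> words n \<and> length \<mu> = k"
  by (simp add: words_of_def words_def)

lemma finite_words_of [simp]: "finite (words_of n k)"
  unfolding words_of_def by (rule finite_lists_length_eq) simp

lemma card_words_of: "card (words_of n k) = n ^ k"
  unfolding words_of_def by (subst card_lists_length_eq) auto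

lemma words_of_0 [simp]: "words_of n 0 = {[]}"
  by (auto simp: words_of_def)

lemma words_append [simp]: "\<mu> @ \<nu> \<in> words n \<longleftrightarrow> \<mu> \<in> words n \<and> \<nu> \<in> words n"
  by (auto simp: words_def)

lemma words_Nil [simp]: "[] \<in> words n"
  by (auto simp: words_def)

lemma words_Cons [simp]: "i # \<mu> \<in> words n \<longleftrightarrow> i \<in> {1..n} \<and> \<mu> \<in> words n"
  by (auto simp: words_def)

lemma words_take [simp]: "\<mu> \<in> words n \<Longrightarrow> take k \<mu> \<in> words n"
  and words_drop [simp]: "\<mu> \<in> words n \<Longrightarrow> drop k \<mu> \<in> words n"
  by (auto simp: words_def dest: in_set_takeD in_set_dropD)

lemma words_replicate [simp]: "i \<in> {1..n} \<Longrightarrow> replicate k i \<in> words n"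
  by (auto simp: words_def)

lemma sum_words_of_Suc:
  "(\<Sum>\<mu>\<in>words_of n (Suc k). f \<mu>) = (\<Sum>i=1..n. \<Sum>\<mu>\<in>words_of n k. f (i # \<mu>))"
proof -
  have "bij_betw (\<lambda>(i, \<mu>). i # \<mu>) ({1..n} \<times> words_of n k) (words_of n (Suc k))"
    by (rule bij_betwI[where g = "\<lambda>\<mu>. (hd \<mu>, tl \<mu>)"])
      (auto simp: words_of_def length_Suc_conv)
  from sum.reindex_bij_betw[OF this, of f] show ?thesis
    by (simp add: sum.cartesian_product case_prod_unfold)
qed

lemma word_elem_Nil [simp]: "word_elem S [] = 1"
  by (simp add: word_elem_def)

lemma word_elem_Cons: "word_elem S (i # \<mu>) = S i * word_elem S \<mu>"
  by (simp add: word_elem_def)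

lemma word_elem_append: "word_elem S (\<mu> @ \<nu>) = word_elem S \<mu> * word_elem S \<nu>"
  by (simp add: word_elem_def)

context cuntz_family
begin

lemma star_word_mult_word:
  assumes "\<mu> \<in> words n" "\<nu> \<in> words n" "length \<mu> = length \<nu>"
  shows "star (w \<mu>) * w \<nu> = (if \<mu> = \<nu> then 1 else 0)"
  using assms(3,1,2)
proof (induction \<mu> \<nu> rule: list_induct2)
  case (Cons i \<mu> j \<nu>)
  have "star (w (i # \<mu>)) * w (j # \<nu>) = star (w \<mu>) * (star (S i) * S j) * w \<nu>"
    by (simp add: word_elem_Cons star_simps mult.assoc)
  then show ?case using Cons star_mult_gen[of i j] by (cases "i = j") auto
qed (simp add: star_one)

lemma word_isometry: "\<mu> \<in> words n \<Longrightarrow> star (w \<mu>) * w \<mu> = 1"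
  by (simp add: star_word_mult_word)

lemma sum_words_monom: "(\<Sum>\<mu>\<in>words_of n k. monom \<mu> \<mu>) = 1"
proof (induction k)
  case (Suc k)
  have "(\<Sum>\<mu>\<in>words_of n (Suc k). monom \<mu> \<mu>) = (\<Sum>i=1..n. S i * (\<Sum>\<mu>\<in>words_of n k. monom \<mu> \<mu>) * star (S i))"
    by (simp add: sum_words_of_Suc monom_def word_elem_Cons star_simps sum_distrib_left sum_distrib_right mult.assoc)
  then show ?case using sum_ranges by (simp add: Suc)
qed (simp add: monom_def star_one)

lemma star_monom: "star (monom \<mu> \<nu>) = monom \<nu> \<mu>"
  by (simp add: monom_def star_simps)

lemma norm_word: "\<mu> \<in> words n \<Longrightarrow> norm (w \<mu>) = 1"
  by (rule norm_isometry[OF word_isometry])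

text \<open>The resolution of 1 from \<open>sum_words_monom\<close> is inserted between the two
  words. The common suffix allows the length of one word to be prescribed while the difference of
  lengths is kept.\<close>

lemma monom_expand: "monom \<mu> \<nu> = (\<Sum>\<kappa>\<in>words_of n k. monom (\<mu> @ \<kappa>) (\<nu> @ \<kappa>))"
proof -
  have "monom \<mu> \<nu> = w \<mu> * (\<Sum>\<kappa>\<in>words_of n k. monom \<kappa> \<kappa>) * star (w \<nu>)"
    unfolding sum_words_monom by (simp add: monom_def)
  then show ?thesis
    by (simp add: monom_def word_elem_append star_simps sum_distrib_left sum_distrib_right mult.assoc)
qed

lemma star_word_mult_word_le:
  assumes "\<nu> \<in> words n" "\<alpha> \<in> words n" "length \<nu> \<le> length \<alpha>"
  shows "star (w \<nu>) * w \<alpha> = (if take (length \<nu>) \<alpha> = \<nu> then w (drop (length \<nu>) \<alpha>) else 0)"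
proof -
  let ?l = "length \<nu>"
  have "star (w \<nu>) * w \<alpha> = (star (w \<nu>) * w (take ?l \<alpha>)) * w (drop ?l \<alpha>)"
    by (metis append_take_drop_id mult.assoc word_elem_append)
  moreover have "star (w \<nu>) * w (take ?l \<alpha>) = (if \<nu> = take ?l \<alpha> then 1 else 0)"
    using assms by (intro star_word_mult_word) auto
  ultimately show ?thesis by auto
qed

lemma monom_mult_le:
  assumes "\<nu> \<in> words n" "\<alpha> \<in> words n" "length \<nu> \<le> length \<alpha>"
  shows "monom \<mu> \<nu> * monom \<alpha> \<beta> =
    (if take (length \<nu>) \<alpha> = \<nu> then monom (\<mu> @ drop (length \<nu>) \<alpha>) \<beta> else 0)"
proof -
  have "monom \<mu> \<nu> * monom \<alpha> \<beta> = w \<mu> * (star (w \<nu>) * w \<alpha>) * star (w \<beta>)"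
    by (simp add: monom_def mult.assoc)
  then show ?thesis using star_word_mult_word_le[OF assms]
    by (simp add: monom_def word_elem_append)
qed

lemma monom_mult_ge:
  assumes "\<nu> \<in> words n" "\<alpha> \<in> words n" "length \<alpha> \<le> length \<nu>"
  shows "monom \<mu> \<nu> * monom \<alpha> \<beta> =
    (if take (length \<alpha>) \<nu> = \<alpha> then monom \<mu> (\<beta> @ drop (length \<alpha>) \<nu>) else 0)"
proof -
  have "monom \<mu> \<nu> * monom \<alpha> \<beta> = star (monom \<beta> \<alpha> * monom \<nu> \<mu>)"
    by (simp add: star_mult star_monom)
  then show ?thesis using monom_mult_le[OF assms(2,1,3)]
    by (simp add: star_monom star_zero)
qed

section \<open>Compression to the core by an isometry of the algebra\<close>

definition sep :: "nat \<Rightarrow> 'a" where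
  "sep N = w (replicate N 1 @ [2])"

lemma sep_word: "replicate N 1 @ [2] \<in> words n"
  using n_ge_2 by simp

lemma sep_isometry: "star (sep N) * sep N = 1"
  unfolding sep_def by (rule word_isometry[OF sep_word])

text \<open>A block of \<open>N\<close> ones closed by a 2 cannot overlap a copy of itself shifted
  by 1 to \<open>N\<close> places: at position \<open>N\<close> the shifted copy has a 1.\<close>

lemma sep_compress:
  assumes "\<kappa> \<in> words n" "\<kappa> \<noteq> []" "length \<kappa> \<le> N"
  shows "star (sep N) * w \<kappa> * sep N = 0"
proof -
  let ?g = "replicate N (1::nat) @ [2]"
  have "take (length ?g) (\<kappa> @ ?g) \<noteq> ?g"
  proof
    assume eq: "take (length ?g) (\<kappa> @ ?g) = ?g"
    have "(\<kappa> @ ?g) ! N = take (length ?g) (\<kappa> @ ?g) ! N"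
      by (rule nth_take[symmetric]) simp
    also have "\<dots> = 2" unfolding eq by (simp add: nth_append)
    finally have "(\<kappa> @ ?g) ! N = 2" .
    moreover have "(\<kappa> @ ?g) ! N = 1"
      using assms by (cases \<kappa>) (auto simp: nth_append)
    ultimately show False by simp
  qed
  then have "star (w ?g) * w (\<kappa> @ ?g) = 0"
    using star_word_mult_word_le[OF sep_word, of "\<kappa> @ ?g" N] sep_word assms by simp
  then show ?thesis by (simp add: sep_def word_elem_append mult.assoc)
qed

text \<open>Copies of \<open>sep N\<close> are placed along the diagonal of the matrix units
  \<open>monom \<alpha> \<beta>\<close> with both words of length \<open>N\<close>; hence this
  isometry commutes with those matrix units.\<close>

definition spread :: "nat \<Rightarrow> 'a" where
  "spread N = (\<Sum>\<alpha>\<in>words_of n N. w \<alpha> * sep N * star (w \<alpha>))"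

lemma star_word_spread:
  assumes "\<alpha> \<in> words_of n N"
  shows "star (w \<alpha>) * spread N = sep N * star (w \<alpha>)"
proof -
  have "star (w \<alpha>) * spread N = (\<Sum>\<beta>\<in>words_of n N. (star (w \<alpha>) * w \<beta>) * sep N * star (w \<beta>))"
    by (simp add: spread_def sum_distrib_left mult.assoc)
  also have "\<dots> = (\<Sum>\<beta>\<in>words_of n N. if \<alpha> = \<beta> then sep N * star (w \<beta>) else 0)"
    using assms by (intro sum.cong refl) (auto simp: words_of_iff star_word_mult_word)
  finally show ?thesis using assms by simp
qed

lemma star_spread_word:
  assumes "\<alpha> \<in> words_of n N"
  shows "star (spread N) * w \<alpha> = w \<alpha> * star (sep N)"
  using arg_cong[OF star_word_spread[OF assms], of star] by (simp add: star_simps)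

lemma spread_isometry: "star (spread N) * spread N = 1"
proof -
  have "star (spread N) * spread N = (\<Sum>\<alpha>\<in>words_of n N. (star (spread N) * w \<alpha>) * sep N * star (w \<alpha>))"
    by (subst (2) spread_def) (simp add: sum_distrib_left mult.assoc)
  also have "\<dots> = (\<Sum>\<alpha>\<in>words_of n N. monom \<alpha> \<alpha>)"
    by (intro sum.cong refl)
      (simp add: star_spread_word monom_def mult.assoc, simp add: sep_isometry flip: mult.assoc)
  finally show ?thesis by (simp add: sum_words_monom)
qed

text \<open>On monomials with words of length at most \<open>N\<close> this is the conditional expectation onto the
  core, but it is defined and contractive on the whole algebra.\<close>

definition core_part :: "nat \<Rightarrow> 'a \<Rightarrow> 'a" where
  "core_part N x = star (spread N) * x * spread N"

lemma norm_core_part: "norm (core_part N x) \<le> norm x"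
  unfolding core_part_def by (rule norm_isometry_conj_le[OF spread_isometry])

lemma core_part_linear:
  "core_part N (x + y) = core_part N x + core_part N y"
  "core_part N (c *\<^sub>C x) = c *\<^sub>C core_part N x"
  "core_part N (\<Sum>i\<in>I. f i) = (\<Sum>i\<in>I. core_part N (f i))"
  "core_part N 0 = 0"
  "core_part N (star x) = star (core_part N x)"
  by (simp_all add: core_part_def algebra_simps scaleC_mult_left scaleC_mult_right star_simps
      sum_distrib_left sum_distrib_right)

text \<open>If the second word is not the longer one, \<open>monom_expand\<close> brings it to
  length \<open>N\<close>. Moving \<open>spread N\<close> past it, and its adjoint past the first
  \<open>N\<close> letters of the first word, leaves the remaining letters between
  \<open>star (sep N)\<close> and \<open>sep N\<close>, which gives 0 unless none remain. Adjoints
  settle the other case.\<close>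

lemma core_part_monom:
  assumes "\<mu> \<in> words n" "\<nu> \<in> words n" "length \<mu> \<le> N" "length \<nu> \<le> N"
  shows "core_part N (monom \<mu> \<nu>) = (if length \<mu> = length \<nu> then monom \<mu> \<nu> else 0)"
proof -
  have *: "core_part N (monom \<mu> \<nu>) = (if length \<mu> = length \<nu> then monom \<mu> \<nu> else 0)"
    if "\<mu> \<in> words n" "\<nu> \<in> words n" "length \<mu> \<le> N" "length \<nu> \<le> length \<mu>" for \<mu> \<nu>
  proof -
    let ?k = "N - length \<nu>"
    have summand: "core_part N (monom (\<mu> @ \<kappa>) (\<nu> @ \<kappa>)) =
        (if length \<mu> = length \<nu> then monom (\<mu> @ \<kappa>) (\<nu> @ \<kappa>) else 0)"
      if \<kappa>: "\<kappa> \<in> words_of n ?k" for \<kappa>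
    proof -
      define \<rho> where "\<rho> = \<mu> @ \<kappa>"
      have \<nu>\<kappa>: "\<nu> @ \<kappa> \<in> words_of n N" and \<rho>: "\<rho> \<in> words n" 
        and len: "length \<rho> = N + (length \<mu> - length \<nu>)"
        using that \<kappa> \<open>\<mu> \<in> _\<close> \<open>\<nu> \<in> _\<close> \<open>length \<mu> \<le> N\<close> \<open>length \<nu> \<le> length \<mu>\<close>
        by (auto simp: words_of_iff \<rho>_def)
      have take: "take N \<rho> \<in> words_of n N"
        using \<rho> len by (simp add: words_of_iff)
      have "core_part N (monom \<rho> (\<nu> @ \<kappa>))
          = star (spread N) * w (take N \<rho>) * w (drop N \<rho>) * (star (w (\<nu> @ \<kappa>)) * spread N)"
        by (metis (no_types, opaque_lifting) append_take_drop_id monom_def core_part_def mult.assoc word_elem_append)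
      also have "\<dots> = w (take N \<rho>) * (star (sep N) * w (drop N \<rho>) * sep N) * star (w (\<nu> @ \<kappa>))"
        using star_word_spread[OF \<nu>\<kappa>] star_spread_word[OF take] by (simp add: mult.assoc)
      also have "star (sep N) * w (drop N \<rho>) * sep N = (if length \<mu> = length \<nu> then 1 else 0)"
        using sep_compress[of "drop N \<rho>" N] \<rho> len \<open>length \<mu> \<le> N\<close> \<open>length \<nu> \<le> length \<mu>\<close>
        by (auto simp: sep_isometry)
      finally show ?thesis
        using len by (auto simp: \<rho>_def monom_def)
    qed
    have "core_part N (monom \<mu> \<nu>) = (\<Sum>\<kappa>\<in>words_of n ?k. core_part N (monom (\<mu> @ \<kappa>) (\<nu> @ \<kappa>)))"
      by (subst monom_expand[of _ _ ?k]) (simp add: core_part_linear)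
    also have "\<dots> = (\<Sum>\<kappa>\<in>words_of n ?k. if length \<mu> = length \<nu> then monom (\<mu> @ \<kappa>) (\<nu> @ \<kappa>) else 0)"
      by (intro sum.cong refl summand)
    finally show ?thesis
      by (auto simp flip: monom_expand)
  qed
  show ?thesis
  proof (cases "length \<nu> \<le> length \<mu>")
    case True then show ?thesis using * assms by blast
  next
    case False
    then have "core_part N (monom \<nu> \<mu>) = 0" using *[of \<nu> \<mu>] assms by simp
    then show ?thesis using False core_part_linear(5)[of N "monom \<nu> \<mu>"]
      by (simp add: star_monom star_zero)
  qed
qed

end

section \<open>Universal property\<close>

lemma norm_power_self_adjoint:
  fixes y :: "'a::cstar_algebra"
  assumes "star y = y"
  shows "norm (y ^ 2 ^ j) = norm y ^ 2 ^ j"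
proof (induction j)
  case (Suc j)
  have "norm (y ^ 2 ^ Suc j) = norm (star (y ^ 2 ^ j) * y ^ 2 ^ j)"
    using assms by (simp add: star_power mult_2 power_add)
  then show ?case
    by (simp add: cstar_identity Suc mult.commute flip: power_mult)
qed simp

text \<open>If c = (1 + \<delta>) d with \<delta> > 0, the square of Bernoulli's inequality makes
  the powers of c / d with exponent 2^(j+1) grow at least like the square of 2^j, against a bound
  linear in 2^j.\<close>

lemma le_of_power_le_linear:
  fixes c d K :: real
  assumes "0 \<le> c" "0 \<le> d" "0 \<le> K" and le: "\<And>j. c ^ 2 ^ j \<le> (K * 2 ^ j + 1) * d ^ 2 ^ j"
  shows "c \<le> d"
proof (rule ccontr)
  assume "\<not> c \<le> d"
  then have cd: "c > d" by simp
  show False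
  proof (cases "d = 0")
    case True
    then show False using le[of 0] cd by simp
  next
    case False
    define \<delta> where "\<delta> = c / d - 1"
    have \<delta>: "\<delta> > 0" using cd False \<open>0 \<le> d\<close> by (simp add: \<delta>_def)
    obtain j :: nat where j: "2 * K / \<delta>\<^sup>2 < 2 ^ j"
      using real_arch_pow[of 2 "2 * K / \<delta>\<^sup>2"] by auto
    let ?m = "2 ^ j :: nat"
    have "1 + real ?m * \<delta> \<le> (1 + \<delta>) ^ ?m"
      using Bernoulli_inequality[of \<delta> ?m] \<delta> by simp
    then have "(1 + real ?m * \<delta>)\<^sup>2 \<le> ((1 + \<delta>) ^ ?m)\<^sup>2"
      using \<delta> by (intro power_mono) auto
    also have "\<dots> = (c / d) ^ 2 ^ Suc j"
      by (simp add: \<delta>_def mult.commute flip: power_mult)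
    also have "\<dots> \<le> K * 2 ^ Suc j + 1"
      using le[of "Suc j"] False \<open>0 \<le> d\<close> unfolding power_divide
      by (subst pos_divide_le_eq) auto
    finally have "(1 + 2 ^ j * \<delta>)\<^sup>2 \<le> K * 2 ^ Suc j + 1" by simp
    moreover have "(1 + 2 ^ j * \<delta>)\<^sup>2 = 1 + 2 * (2 ^ j * \<delta>) + 2 ^ j * (2 ^ j * \<delta>\<^sup>2)"
      by (simp add: power2_eq_square algebra_simps)
    moreover have "0 < 2 ^ j * \<delta>" using \<delta> by simp
    ultimately have "2 ^ j * (2 ^ j * \<delta>\<^sup>2) \<le> 2 ^ j * (2 * K)"
      unfolding power_Suc by (simp only: ac_simps)
    then have "2 ^ j * \<delta>\<^sup>2 \<le> 2 * K" by simp
    then show False using j \<delta> by (simp add: field_simps)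
  qed
qed

section \<open>Polynomials with words of bounded length\<close>

context cuntz_family
begin

definition level :: "nat \<Rightarrow> 'a set" where
  "level N = complex_vs.span
     {monom \<mu> \<nu> | \<mu> \<nu>. \<mu> \<in> words n \<and> \<nu> \<in> words n \<and> length \<mu> \<le> N \<and> length \<nu> \<le> N}"

lemma monom_in_level:
  "\<mu> \<in> words n \<Longrightarrow> \<nu> \<in> words n \<Longrightarrow> length \<mu> \<le> N \<Longrightarrow> length \<nu> \<le> N \<Longrightarrow> monom \<mu> \<nu> \<in> level N"
  unfolding level_def by (rule complex_vs.span_base) blast

lemma level_mono: "N \<le> M \<Longrightarrow> level N \<subseteq> level M"
  unfolding level_def by (rule complex_vs.span_mono) fastforce

lemma subspace_level [simp]: "complex_vs.subspace (level N)"
  by (simp add: level_def)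

lemma level_0: "0 \<in> level N"
  by (simp add: level_def complex_vs.span_zero)

lemma level_induct [consumes 1, case_names monom zero add scale]:
  assumes "x \<in> level N"
    and "\<And>\<mu> \<nu>. \<mu> \<in> words n \<Longrightarrow> \<nu> \<in> words n \<Longrightarrow> length \<mu> \<le> N \<Longrightarrow> length \<nu> \<le> N \<Longrightarrow> P (monom \<mu> \<nu>)"
    and "P 0" "\<And>x y. P x \<Longrightarrow> P y \<Longrightarrow> P (x + y)" "\<And>c x. P x \<Longrightarrow> P (c *\<^sub>C x)"
  shows "P x"
  using assms(1) unfolding level_def
  by (rule complex_vs.span_induct) (auto simp: complex_vs.subspace_def intro: assms)

lemma level_star: "x \<in> level N \<Longrightarrow> star x \<in> level N"
proof (induction rule: level_induct)
  case (monom \<mu> \<nu>)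
  then show ?case by (simp add: star_monom monom_in_level)
qed (simp_all add: star_simps complex_vs.subspace_add complex_vs.subspace_scale level_0)

end

section \<open>Lifting polynomials from one Cuntz family to another\<close>

locale cuntz_family_pair = S: cuntz_family n S + T: cuntz_family n T
  for n and S T :: "nat \<Rightarrow> 'a::cstar_algebra"
begin

text \<open>For \<open>T i = u * S i\<close> this is the usual cocycle of \<open>u\<close>, with
  value \<open>u\<close> at k = 1. It converts words of a prescribed length by multiplication alone,
  so that norms stay under control.\<close>

definition transfer :: "nat \<Rightarrow> 'a" where
  "transfer k = (\<Sum>\<mu>\<in>words_of n k. word_elem T \<mu> * star (word_elem S \<mu>))"

lemma transfer_word:
  assumes "\<mu> \<in> words_of n k"
  shows "transfer k * word_elem S \<mu> = word_elem T \<mu>"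
proof -
  have "transfer k * word_elem S \<mu> = (\<Sum>\<nu>\<in>words_of n k. word_elem T \<nu> * (star (word_elem S \<nu>) * word_elem S \<mu>))"
    by (simp add: transfer_def sum_distrib_right mult.assoc)
  also have "\<dots> = (\<Sum>\<nu>\<in>words_of n k. if \<nu> = \<mu> then word_elem T \<nu> else 0)"
    using assms by (intro sum.cong refl) (auto simp: words_of_iff S.star_word_mult_word)
  finally show ?thesis using assms by simp
qed

lemma word_transfer:
  assumes "\<mu> \<in> words_of n k"
  shows "star (word_elem S \<mu>) * star (transfer k) = star (word_elem T \<mu>)"
  using arg_cong[OF transfer_word[OF assms], of star] by (simp add: star_simps)

lemma transfer_isometry: "star (transfer k) * transfer k = 1"
proof -
  have "star (word_elem T \<mu>) * transfer k = star (word_elem S \<mu>)" if "\<mu> \<in> words_of n k" for \<mu>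
  proof -
    have "star (word_elem T \<mu>) * transfer k
        = (\<Sum>\<nu>\<in>words_of n k. (star (word_elem T \<mu>) * word_elem T \<nu>) * star (word_elem S \<nu>))"
      by (simp add: transfer_def sum_distrib_left mult.assoc)
    also have "\<dots> = (\<Sum>\<nu>\<in>words_of n k. if \<mu> = \<nu> then star (word_elem S \<nu>) else 0)"
      using that by (intro sum.cong refl) (auto simp: words_of_iff T.star_word_mult_word)
    finally show ?thesis using that by simp
  qed
  then have "(\<Sum>\<mu>\<in>words_of n k. word_elem S \<mu> * (star (word_elem T \<mu>) * transfer k))
      = (\<Sum>\<mu>\<in>words_of n k. S.monom \<mu> \<mu>)"
    by (intro sum.cong) (auto simp: S.monom_def)
  moreover have "star (transfer k) * transfer k
      = (\<Sum>\<mu>\<in>words_of n k. word_elem S \<mu> * (star (word_elem T \<mu>) * transfer k))"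
    by (subst transfer_def) (simp add: star_simps sum_distrib_right mult.assoc)
  ultimately show ?thesis by (simp add: S.sum_words_monom)
qed

text \<open>The component of degree b - N, the degree being the difference of the two word lengths:
  prepended ones shift this degree to 0, \<open>core_part\<close> selects it, and the ones are
  removed. For b \<le> 2 N and words of length at most \<open>N\<close> the padded words have length
  at most 3 N.\<close>

definition homogeneous_part :: "nat \<Rightarrow> nat \<Rightarrow> 'a \<Rightarrow> 'a" where
  "homogeneous_part b N x =
     star (word_elem S (replicate N 1)) *
     S.core_part (3 * N) (word_elem S (replicate N 1) * x * star (word_elem S (replicate b 1))) *
     word_elem S (replicate b 1)"

lemma one_word: "replicate k 1 \<in> words n"
  using S.n_ge_2 by simp

lemma homogeneous_part_monom:
  assumes "\<mu> \<in> words n" "\<nu> \<in> words n" "length \<mu> \<le> N" "length \<nu> \<le> N" "b \<le> 2 * N"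
  shows "homogeneous_part b N (S.monom \<mu> \<nu>) =
    (if N + length \<mu> = b + length \<nu> then S.monom \<mu> \<nu> else 0)"
proof -
  let ?o = "\<lambda>k. replicate k (1::nat)"
  have "word_elem S (?o N) * S.monom \<mu> \<nu> * star (word_elem S (?o b))
      = S.monom (?o N @ \<mu>) (?o b @ \<nu>)"
    by (simp add: S.monom_def word_elem_append star_simps mult.assoc)
  moreover have "S.core_part (3 * N) (S.monom (?o N @ \<mu>) (?o b @ \<nu>)) =
      (if N + length \<mu> = b + length \<nu> then S.monom (?o N @ \<mu>) (?o b @ \<nu>) else 0)"
    using assms one_word by (subst S.core_part_monom) auto
  moreover have "star (word_elem S (?o N)) * S.monom (?o N @ \<mu>) (?o b @ \<nu>) * word_elem S (?o b)
      = (star (word_elem S (?o N)) * word_elem S (?o N)) * S.monom \<mu> \<nu> *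
        (star (word_elem S (?o b)) * word_elem S (?o b))"
    by (simp add: S.monom_def word_elem_append star_simps mult.assoc)
  ultimately show ?thesis
    unfolding homogeneous_part_def using S.word_isometry[OF one_word] by simp
qed

lemma norm_homogeneous_part: "norm (homogeneous_part b N x) \<le> norm x"
proof -
  have "norm (homogeneous_part b N x) \<le>
      norm (S.core_part (3 * N) (word_elem S (replicate N 1) * x * star (word_elem S (replicate b 1))))"
    (is "_ \<le> norm (S.core_part _ ?y)")
    unfolding homogeneous_part_def
    using norm_mult_ineq order_trans mult_right_mono norm_ge_zero S.norm_word[OF one_word] norm_star
    by (smt (verit) mult_cancel_left1 mult_cancel_right1)
  also have "\<dots> \<le> norm ?y" by (rule S.norm_core_part)
  also have "\<dots> \<le> norm x"
    using norm_mult_ineq order_trans mult_right_mono norm_ge_zero S.norm_word[OF one_word] norm_star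
    by (smt (verit) mult_cancel_left1 mult_cancel_right1)
  finally show ?thesis .
qed

text \<open>By \<open>monom_expand\<close>, a monomial of degree b - N whose second word has length
  at most \<open>N\<close> is a sum of monomials with word lengths exactly \<open>b\<close> and
  \<open>N\<close>, so one \<open>transfer\<close> on each side turns \<open>S\<close> into
  \<open>T\<close>. The range of \<open>b\<close> covers the degrees from -N to N.\<close>

definition lift :: "nat \<Rightarrow> 'a \<Rightarrow> 'a" where
  "lift N x = (\<Sum>b\<le>2 * N. transfer b * homogeneous_part b N x * star (transfer N))"

lemma lift_linear:
  "lift N (x + y) = lift N x + lift N y"
  "lift N (c *\<^sub>C x) = c *\<^sub>C lift N x"
  "lift N 0 = 0"
  by (simp_all add: lift_def homogeneous_part_def S.core_part_linear algebra_simps sum.distrib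
      scaleC_mult_left scaleC_mult_right complex_vs.scale_sum_right)

lemma norm_lift: "norm (lift N x) \<le> (2 * real N + 1) * norm x"
proof -
  have "norm (transfer b * homogeneous_part b N x * star (transfer N)) \<le> norm x" for b
  proof -
    have "norm (transfer b * homogeneous_part b N x * star (transfer N))
        \<le> norm (transfer b) * norm (homogeneous_part b N x) * norm (star (transfer N))"
      by (meson mult_right_mono norm_ge_zero norm_mult_ineq order_trans)
    then show ?thesis
      using norm_homogeneous_part[of b N x] by (simp add: norm_star norm_isometry[OF transfer_isometry])
  qed
  then have "norm (lift N x) \<le> (\<Sum>b\<le>2 * N. norm x)"
    unfolding lift_def by (intro sum_norm_le)
  then show ?thesis by (simp add: algebra_simps)
qed

lemma lift_monom:
  assumes "\<mu> \<in> words n" "\<nu> \<in> words n" "length \<mu> \<le> N" "length \<nu> \<le> N"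
  shows "lift N (S.monom \<mu> \<nu>) = T.monom \<mu> \<nu>"
proof -
  \<comment> \<open>The length of the first word once the second has been padded to length
    \<open>N\<close>.\<close>
  define b where "b = N + length \<mu> - length \<nu>"
  have b: "b \<le> 2 * N" "N + length \<mu> = c + length \<nu> \<longleftrightarrow> c = b" for c
    using assms by (auto simp: b_def)
  have "lift N (S.monom \<mu> \<nu>) =
      (\<Sum>c\<le>2 * N. if c = b then transfer b * S.monom \<mu> \<nu> * star (transfer N) else 0)"
    unfolding lift_def
    by (intro sum.cong refl, subst homogeneous_part_monom) (use assms b in auto)
  also have "\<dots> = transfer b * S.monom \<mu> \<nu> * star (transfer N)"
    using b by simp
  also have "\<dots> = (\<Sum>\<kappa>\<in>words_of n (N - length \<nu>).
      (transfer b * word_elem S (\<mu> @ \<kappa>)) * (star (word_elem S (\<nu> @ \<kappa>)) * star (transfer N)))"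
    by (subst S.monom_expand[of _ _ "N - length \<nu>"])
      (simp add: S.monom_def sum_distrib_left sum_distrib_right mult.assoc)
  also have "\<dots> = (\<Sum>\<kappa>\<in>words_of n (N - length \<nu>). T.monom (\<mu> @ \<kappa>) (\<nu> @ \<kappa>))"
    using assms
    by (intro sum.cong refl, subst transfer_word, simp add: words_of_iff b_def,
        subst word_transfer, simp add: words_of_iff, simp add: T.monom_def)
  finally show ?thesis by (simp flip: T.monom_expand)
qed

lemma lift_level_mono:
  assumes "x \<in> S.level N" "N \<le> M"
  shows "lift M x = lift N x"
  using assms
  by (induction rule: S.level_induct) (auto simp: lift_linear lift_monom)

lemma lift_star: "x \<in> S.level N \<Longrightarrow> lift N (star x) = star (lift N x)"
  by (induction rule: S.level_induct)
    (auto simp: lift_linear lift_monom star_simps S.star_monom T.star_monom)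

text \<open>Both families obey the same multiplication rules for monomials; what remains is to bound
  the word lengths of the product.\<close>

lemma lift_mult:
  assumes x: "x \<in> S.level N" and y: "y \<in> S.level M"
  shows "x * y \<in> S.level (N + M) \<and> lift (N + M) (x * y) = lift N x * lift M y"
  using x
proof (induction rule: S.level_induct)
  case (monom \<mu> \<nu>)
  show ?case using y
  proof (induction rule: S.level_induct)
    case (monom \<alpha> \<beta>)
    note a = \<open>\<mu> \<in> _\<close> \<open>\<nu> \<in> _\<close> \<open>\<alpha> \<in> _\<close> \<open>\<beta> \<in> _\<close> \<open>length \<mu> \<le> _\<close> \<open>length \<nu> \<le> _\<close> \<open>length \<alpha> \<le> _\<close> \<open>length \<beta> \<le> _\<close>
    show ?case
    proof (cases "length \<nu> \<le> length \<alpha>")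
      case True
      then show ?thesis using a
        by (auto simp: lift_monom S.monom_mult_le T.monom_mult_le S.level_0 lift_linear S.monom_in_level)
    next
      case False
      then show ?thesis using a
        by (auto simp: lift_monom S.monom_mult_ge T.monom_mult_ge S.level_0 lift_linear S.monom_in_level)
    qed
  qed (auto simp: lift_linear S.level_0 distrib_left scaleC_mult_right complex_vs.subspace_add complex_vs.subspace_scale)
qed (auto simp: lift_linear S.level_0 distrib_right scaleC_mult_left complex_vs.subspace_add complex_vs.subspace_scale)

lemma lift_power:
  assumes "x \<in> S.level N"
  shows "x ^ k \<in> S.level (k * N) \<and> lift (k * N) (x ^ k) = lift N x ^ k"
proof (induction k)
  case 0
  then show ?case
    using S.monom_in_level[of "[]" "[]" 0] lift_monom[of "[]" "[]" 0]
    by (simp add: S.monom_def T.monom_def star_one)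
next
  case (Suc k)
  then show ?case using lift_mult[OF assms, of "x ^ k" "k * N"] by simp
qed

text \<open>Passing to the powers \<open>(star x * x) ^ 2 ^ j\<close>, the C*-identity turns the linearly growing
  bound \<open>norm_lift\<close> into a contraction.\<close>

lemma lift_contraction:
  assumes x: "x \<in> S.level N"
  shows "norm (lift N x) \<le> norm x"
proof -
  let ?z = "star x * x" and ?N = "N + N"
  have z: "?z \<in> S.level ?N" and lz: "lift ?N ?z = star (lift N x) * lift N x"
    using lift_mult[OF S.level_star[OF x] x] lift_star[OF x] by auto
  have "norm (lift ?N ?z) ^ 2 ^ j \<le> ((2 * real ?N) * 2 ^ j + 1) * norm ?z ^ 2 ^ j" for j
  proof -
    have "norm (lift ?N ?z) ^ 2 ^ j = norm (lift (2 ^ j * ?N) (?z ^ 2 ^ j))"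
      using lift_power[OF z, of "2 ^ j"]
        norm_power_self_adjoint[of "lift ?N ?z" j] by (simp add: lz star_simps)
    also have "\<dots> \<le> (2 * real (2 ^ j * ?N) + 1) * norm (?z ^ 2 ^ j)"
      by (rule norm_lift)
    also have "norm (?z ^ 2 ^ j) = norm ?z ^ 2 ^ j"
      by (rule norm_power_self_adjoint) (simp add: star_simps)
    finally show ?thesis by (simp add: ac_simps)
  qed
  then have "norm (lift ?N ?z) \<le> norm ?z"
    by (rule le_of_power_le_linear[rotated 3]) auto
  then show ?thesis by (simp add: lz cstar_identity)
qed

end

section \<open>Closures of subspaces and of products\<close>

lemma subspace_closure:
  fixes V :: "'a::cstar_algebra set"
  assumes "complex_vs.subspace V"
  shows "complex_vs.subspace (closure V)"
  unfolding complex_vs.subspace_def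
proof (intro conjI ballI allI)
  show "0 \<in> closure V"
    using assms closure_subset by (auto simp: complex_vs.subspace_def)
next
  fix x y assume "x \<in> closure V" "y \<in> closure V"
  then obtain f g where "\<forall>k. f k \<in> V" "f \<longlonglongrightarrow> x" "\<forall>k. g k \<in> V" "g \<longlonglongrightarrow> y"
    by (auto simp: closure_sequential)
  then show "x + y \<in> closure V"
    using assms unfolding closure_sequential complex_vs.subspace_def
    by (intro exI[of _ "\<lambda>k. f k + g k"]) (auto intro: tendsto_add)
next
  fix c x assume "x \<in> closure V"
  then obtain f where "\<forall>k. f k \<in> V" "f \<longlonglongrightarrow> x" by (auto simp: closure_sequential)
  then show "c *\<^sub>C x \<in> closure V"
    using assms unfolding closure_sequential complex_vs.subspace_def
    by (intro exI[of _ "\<lambda>k. c *\<^sub>C f k"])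
      (auto intro: bounded_linear.tendsto[OF bounded_linear_scaleC])
qed

lemma closure_mult:
  fixes x y :: "'a::real_normed_algebra"
  assumes "x \<in> closure A" "y \<in> closure B" and AB: "\<And>a b. a \<in> A \<Longrightarrow> b \<in> B \<Longrightarrow> a * b \<in> C"
  shows "x * y \<in> closure C"
proof -
  obtain f g where "\<forall>k. f k \<in> A" "f \<longlonglongrightarrow> x" "\<forall>k. g k \<in> B" "g \<longlonglongrightarrow> y"
    using assms by (auto simp: closure_sequential)
  then show ?thesis using AB unfolding closure_sequential
    by (intro exI[of _ "\<lambda>k. f k * g k"]) (auto intro: tendsto_mult)
qed

lemma closure_star:
  assumes "x \<in> closure A" and "\<And>a. a \<in> A \<Longrightarrow> star a \<in> B"
  shows "star x \<in> closure B"
proof -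
  obtain f where "\<forall>k. f k \<in> A" "f \<longlonglongrightarrow> x" using assms by (auto simp: closure_sequential)
  then show ?thesis using assms(2) unfolding closure_sequential
    by (intro exI[of _ "\<lambda>k. star (f k)"])
      (auto intro: bounded_linear.tendsto[OF bounded_linear_star])
qed

section \<open>Density of the polynomials and extension to the whole algebra\<close>

locale cuntz_algebra = cuntz_family +
  assumes generated: "cstar_generated (S ` {1..n}) = UNIV"
begin

lemma generated_induct:
  assumes "cstar_subalgebra B" "S ` {1..n} \<subseteq> B"
  shows "x \<in> B"
  using generated assms unfolding cstar_generated_def by blast

lemma level_mult:
  assumes "x \<in> level N" "y \<in> level M"
  shows "x * y \<in> level (N + M)"
proof -
  \<comment> \<open>The membership half of \<open>lift_mult\<close> concerns only the first family,
    which can therefore be paired with itself.\<close>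
  interpret cuntz_family_pair n S S by unfold_locales
  show ?thesis using lift_mult[OF assms] by blast
qed

lemma subspace_Union_level: "complex_vs.subspace (\<Union>N. level N)"
  unfolding complex_vs.subspace_def
proof (intro conjI ballI allI)
  fix x y assume "x \<in> (\<Union>N. level N)" "y \<in> (\<Union>N. level N)"
  then obtain N M where "x \<in> level N" "y \<in> level M" by auto
  then have "x \<in> level (max N M)" "y \<in> level (max N M)"
    using level_mono[of N "max N M"] level_mono[of M "max N M"] by auto
  then show "x + y \<in> (\<Union>N. level N)"
    using complex_vs.subspace_add[OF subspace_level] by blast
qed (auto simp: level_0 intro: complex_vs.subspace_scale[OF subspace_level])

lemma closure_Union_level: "closure (\<Union>N. level N) = UNIV"
proof -
  let ?P = "\<Union>N. level N"
  have "x * y \<in> closure ?P" if "x \<in> closure ?P" "y \<in> closure ?P" for x y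
    by (rule closure_mult[OF that]) (use level_mult in blast)
  moreover have "star x \<in> closure ?P" if "x \<in> closure ?P" for x
    by (rule closure_star[OF that]) (use level_star in blast)
  ultimately have "cstar_subalgebra (closure ?P)"
    unfolding cstar_subalgebra_def by (simp add: subspace_closure subspace_Union_level)
  moreover have "S i \<in> level 1" if "i \<in> {1..n}" for i
    using monom_in_level[of "[i]" "[]" 1] that by (simp add: monom_def word_elem_Cons star_one)
  then have "S ` {1..n} \<subseteq> closure ?P"
    using closure_subset[of ?P] by blast
  ultimately show ?thesis
    using generated_induct by blast
qed

lemma continuous_eq_on_levels:
  fixes F G :: "'a \<Rightarrow> 'a"
  assumes "continuous_on UNIV F" "continuous_on UNIV G" and eq: "\<And>x N. x \<in> level N \<Longrightarrow> F x = G x"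
  shows "F x = G x"
proof -
  have "closed {x. F x = G x}" using assms by (intro closed_Collect_eq) auto
  then have "closure (\<Union>N. level N) \<subseteq> {x. F x = G x}"
    by (rule closure_minimal[rotated]) (use eq in blast)
  then show ?thesis using closure_Union_level by auto
qed

text \<open>The maps \<open>lift N\<close> agree on common levels and are contractive there, so
  together they extend by uniform continuity from the dense union of the levels. The algebraic
  identities pass to the limit.\<close>

theorem universal:
  assumes "cuntz_family n T"
  obtains \<phi> where "unital_star_endo \<phi>" "continuous_on UNIV \<phi>" "\<And>i. i \<in> {1..n} \<Longrightarrow> \<phi> (S i) = T i"
proof -
  interpret T: cuntz_family n T by fact
  interpret cuntz_family_pair n S T by unfold_locales
  define P where "P = (\<Union>N. level N)"
  \<comment> \<open>By \<open>lift_level_mono\<close> every level that contains \<open>x\<close>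
    gives the same value; the least one is a canonical choice.\<close>
  define f where "f x = lift (LEAST N. x \<in> level N) x" for x
  have f_eq: "f x = lift N x" if "x \<in> level N" for x N
    unfolding f_def
    by (rule lift_level_mono[symmetric]) (rule LeastI[of "\<lambda>N. x \<in> level N"] Least_le, rule that)+
  have f_add: "f (x + y) = f x + f y" and f_mult: "f (x * y) = f x * f y" if xy: "x \<in> P" "y \<in> P" for x y
  proof -
    obtain N M where N: "x \<in> level N" and M: "y \<in> level M" using xy by (auto simp: P_def)
    then have NM: "x \<in> level (max N M)" "y \<in> level (max N M)"
      using level_mono[of N "max N M"] level_mono[of M "max N M"] by auto
    then have "x + y \<in> level (max N M)" by (simp add: complex_vs.subspace_add)
    then show "f (x + y) = f x + f y" using NM by (simp add: f_eq lift_linear)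
    show "f (x * y) = f x * f y" using lift_mult[OF N M] f_eq[OF N] f_eq[OF M] f_eq[of "x * y" "N + M"] by simp
  qed
  have f_scale: "f (c *\<^sub>C x) = c *\<^sub>C f x" and f_star: "f (star x) = star (f x)"
    and f_norm: "norm (f x) \<le> norm x" if x: "x \<in> P" for x c
  proof -
    obtain N where N: "x \<in> level N" using x by (auto simp: P_def)
    then show "f (c *\<^sub>C x) = c *\<^sub>C f x"
      by (simp add: f_eq[of _ N] complex_vs.subspace_scale lift_linear)
    show "f (star x) = star (f x)" "norm (f x) \<le> norm x"
      using N by (simp_all add: f_eq[of _ N] level_star lift_star lift_contraction)
  qed
  have P_sub: "complex_vs.subspace P" unfolding P_def by (rule subspace_Union_level)
  have uc: "uniformly_continuous_on P f"
    unfolding uniformly_continuous_on_def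
  proof (intro allI impI)
    fix e :: real assume "e > 0"
    have "dist (f y) (f x) < e" if "x \<in> P" "y \<in> P" "dist y x < e" for x y
    proof -
      have xy: "x - y \<in> P" using that P_sub by (simp add: complex_vs.subspace_diff)
      have "f y - f x = - f (x - y)"
        using f_add[OF xy \<open>y \<in> P\<close>] by simp
      then show ?thesis using f_norm[OF xy] that by (simp add: dist_norm norm_minus_commute)
    qed
    then show "\<exists>d>0. \<forall>x\<in>P. \<forall>y\<in>P. dist y x < d \<longrightarrow> dist (f y) (f x) < e"
      using \<open>e > 0\<close> by blast
  qed
  obtain g where g_cont: "uniformly_continuous_on (closure P) g" and g: "\<And>x. x \<in> P \<Longrightarrow> f x = g x"
    by (rule uniformly_continuous_on_extension_on_closure[OF uc], rule that)
  have cont: "continuous_on UNIV g"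
    using uniformly_continuous_imp_continuous[OF g_cont] closure_Union_level by (simp add: P_def)
  have cont': "continuous_on UNIV (\<lambda>x. g (h x))" if "continuous_on UNIV h" for h :: "'a \<Rightarrow> 'a"
    using continuous_on_compose2[OF cont that] by simp
  note ci = cont cont' continuous_intros
    bounded_linear.continuous_on[OF bounded_linear_star] bounded_linear.continuous_on[OF bounded_linear_scaleC]
  have inP: "x \<in> level N \<Longrightarrow> x \<in> P" for x N by (auto simp: P_def)
  \<comment> \<open>Density is used in one variable at a time: first \<open>x\<close>, then
    \<open>y\<close> is restricted to polynomials.\<close>
  have "g (x + y) = g x + g y" for x y
  proof (rule continuous_eq_on_levels[of "\<lambda>x. g (x + y)"])
    fix x N assume x: "x \<in> level N"
    show "g (x + y) = g x + g y"
    proof (rule continuous_eq_on_levels[of "\<lambda>y. g (x + y)"])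
      fix y M assume "y \<in> level M"
      then show "g (x + y) = g x + g y"
        using x P_sub by (metis complex_vs.subspace_add f_add g inP)
    qed (intro ci)+
  qed (intro ci)+
  moreover have "g (x * y) = g x * g y" for x y
  proof (rule continuous_eq_on_levels[of "\<lambda>x. g (x * y)"])
    fix x N assume x: "x \<in> level N"
    show "g (x * y) = g x * g y"
    proof (rule continuous_eq_on_levels[of "\<lambda>y. g (x * y)"])
      fix y M assume "y \<in> level M"
      then show "g (x * y) = g x * g y"
        using x by (metis level_mult f_mult g inP)
    qed (intro ci)+
  qed (intro ci)+
  moreover have "g (c *\<^sub>C x) = c *\<^sub>C g x" for c x
    by (rule continuous_eq_on_levels[of "\<lambda>x. g (c *\<^sub>C x)"], (intro ci)+)
      (metis complex_vs.subspace_scale[OF P_sub] f_scale g inP)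
  moreover have "g (star x) = star (g x)" for x
    by (rule continuous_eq_on_levels[of "\<lambda>x. g (star x)"], (intro ci)+)
      (metis level_star f_star g inP)
  moreover have g_monom: "g (monom \<mu> \<nu>) = T.monom \<mu> \<nu>" if "\<mu> \<in> words n" "\<nu> \<in> words n" for \<mu> \<nu>
    using monom_in_level[OF that, of "max (length \<mu>) (length \<nu>)"] that
    by (simp add: f_eq lift_monom inP flip: g)
  moreover have "g 1 = 1"
    using g_monom[of "[]" "[]"] by (simp add: monom_def T.monom_def star_one)
  moreover have "g (S i) = T i" if "i \<in> {1..n}" for i
    using g_monom[of "[i]" "[]"] that by (simp add: monom_def T.monom_def star_one word_elem_Cons)
  ultimately show thesis
    using that[of g] cont unfolding unital_star_endo_def by blast
qed

end

section \<open>Distance from unitaries to elements of negative degree\<close>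

lemma span_image_finite:
  fixes f :: "'b \<Rightarrow> 'a::cstar_algebra"
  assumes "finite F" "x \<in> complex_vs.span (f ` F)"
  obtains c where "x = (\<Sum>p\<in>F. c p *\<^sub>C f p)"
proof -
  have "\<exists>c. x = (\<Sum>p\<in>F. c p *\<^sub>C f p)"
    using assms(2)
  proof (rule complex_vs.span_induct)
    show "complex_vs.subspace {x. \<exists>c. x = (\<Sum>p\<in>F. c p *\<^sub>C f p)}"
      unfolding complex_vs.subspace_def
    proof (intro conjI ballI allI)
      show "0 \<in> {x. \<exists>c. x = (\<Sum>p\<in>F. c p *\<^sub>C f p)}"
        by (auto intro!: exI[of _ "\<lambda>_. 0"])
    next
      fix x y assume "x \<in> {x. \<exists>c. x = (\<Sum>p\<in>F. c p *\<^sub>C f p)}" "y \<in> {x. \<exists>c. x = (\<Sum>p\<in>F. c p *\<^sub>C f p)}"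
      then obtain c d where "x = (\<Sum>p\<in>F. c p *\<^sub>C f p)" "y = (\<Sum>p\<in>F. d p *\<^sub>C f p)" by blast
      then show "x + y \<in> {x. \<exists>c. x = (\<Sum>p\<in>F. c p *\<^sub>C f p)}"
        by (auto intro!: exI[of _ "\<lambda>p. c p + d p"] simp: scaleC_add_left sum.distrib)
    next
      fix r x assume "x \<in> {x. \<exists>c. x = (\<Sum>p\<in>F. c p *\<^sub>C f p)}"
      then obtain c where "x = (\<Sum>p\<in>F. c p *\<^sub>C f p)" by blast
      then show "r *\<^sub>C x \<in> {x. \<exists>c. x = (\<Sum>p\<in>F. c p *\<^sub>C f p)}"
        by (auto intro!: exI[of _ "\<lambda>p. r * c p"] simp: complex_vs.scale_sum_right scaleC_scaleC)
    qed
  next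
    fix y assume "y \<in> f ` F"
    then obtain q where "q \<in> F" "y = f q" by blast
    then show "\<exists>c. y = (\<Sum>p\<in>F. c p *\<^sub>C f p)"
      using assms(1) by (intro exI[of _ "\<lambda>p. if p = q then 1 else 0"])
        (simp add: if_distrib[of "\<lambda>c. c *\<^sub>C _"] scaleC_one cong: if_cong)
  qed
  then show thesis using that by blast
qed

lemma card_words_of_prefix:
  assumes "\<mu> \<in> words n" "length \<mu> \<le> N"
  shows "card {\<kappa> \<in> words_of n N. take (length \<mu>) \<kappa> = \<mu>} = n ^ (N - length \<mu>)"
proof -
  have "{\<kappa> \<in> words_of n N. take (length \<mu>) \<kappa> = \<mu>} = (@) \<mu> ` words_of n (N - length \<mu>)"
  proof (intro set_eqI iffI)
    fix \<kappa> assume "\<kappa> \<in> {\<kappa> \<in> words_of n N. take (length \<mu>) \<kappa> = \<mu>}"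
    then show "\<kappa> \<in> (@) \<mu> ` words_of n (N - length \<mu>)"
      by (intro image_eqI[of _ _ "drop (length \<mu>) \<kappa>"])
        (auto simp: words_of_iff, metis append_take_drop_id)
  qed (use assms in \<open>auto simp: words_of_iff\<close>)
  then show ?thesis by (simp add: card_image inj_on_def card_words_of)
qed

section \<open>The canonical KMS state and the filtration by degree\<close>

context cuntz_family
begin

text \<open>On \<open>level N\<close> this is the canonical KMS state, with values in the scalar multiples of 1.\<close>

definition kms :: "nat \<Rightarrow> 'a \<Rightarrow> 'a" where
  "kms N x = (1 / n ^ N) *\<^sub>R (\<Sum>\<kappa>\<in>words_of n N. star (w \<kappa>) * core_part N x * w \<kappa>)"

lemma norm_kms: "norm (kms N x) \<le> norm x"
proof -
  have "norm (star (w \<kappa>) * core_part N x * w \<kappa>) \<le> norm x" if "\<kappa> \<in> words_of n N" for \<kappa>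
    using norm_isometry_conj_le[OF word_isometry, of \<kappa> "core_part N x"] norm_core_part[of N x] that
    by (simp add: words_of_iff)
  then have "norm (\<Sum>\<kappa>\<in>words_of n N. star (w \<kappa>) * core_part N x * w \<kappa>) \<le> (\<Sum>\<kappa>\<in>words_of n N. norm x)"
    by (rule sum_norm_le)
  then show ?thesis using n_ge_2 by (simp add: kms_def card_words_of field_simps)
qed

lemma kms_linear:
  "kms N (x + y) = kms N x + kms N y"
  "kms N (x - y) = kms N x - kms N y"
  "kms N (c *\<^sub>C x) = c *\<^sub>C kms N x"
  "kms N (star x) = star (kms N x)"
  "kms N 0 = 0"
proof -
  show add: "kms N (x + y) = kms N x + kms N y" and scale: "kms N (c *\<^sub>C x) = c *\<^sub>C kms N x" for x y c
    by (simp_all add: kms_def core_part_linear algebra_simps sum.distrib scaleC_mult_left scaleC_mult_right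
        complex_vs.scale_sum_right scaleR_eq_scaleC scaleC_scaleC)
  show "kms N (x - y) = kms N x - kms N y"
    using add[of "x - y" y] by (simp add: algebra_simps)
  show "kms N (star x) = star (kms N x)"
    by (simp add: kms_def core_part_linear star_simps mult.assoc)
  show "kms N 0 = 0" using scale[of 0 0] by simp
qed

lemma kms_sum: "kms N (\<Sum>i\<in>I. f i) = (\<Sum>i\<in>I. kms N (f i))"
  by (induction I rule: infinite_finite_induct) (auto simp: kms_linear)

text \<open>Conjugation by \<open>w \<kappa>\<close> turns a monomial with both words equal to \<mu>
  into 1 if \<kappa> begins with \<mu>, and into 0 otherwise. A fraction n^(-length \<mu>) of the
  words of length \<open>N\<close> begins with \<mu>.\<close>

lemma kms_monom:
  assumes \<mu>: "\<mu> \<in> words n" "length \<mu> \<le> N" and \<nu>: "\<nu> \<in> words n" "length \<nu> \<le> N"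
  shows "kms N (monom \<mu> \<nu>) = of_real (if \<mu> = \<nu> then 1 / n ^ length \<mu> else 0)"
proof (cases "length \<mu> = length \<nu>")
  case False
  then show ?thesis using assms by (auto simp: kms_def core_part_monom)
next
  case len: True
  let ?A = "{\<kappa> \<in> words_of n N. take (length \<mu>) \<kappa> = \<mu>}"
  have "star (w \<kappa>) * monom \<mu> \<nu> * w \<kappa> = (if \<kappa> \<in> ?A \<and> \<mu> = \<nu> then 1 else 0)"
    if \<kappa>: "\<kappa> \<in> words_of n N" for \<kappa>
  proof -
    have "star (w \<kappa>) * monom \<mu> \<nu> * w \<kappa> = star (star (w \<mu>) * w \<kappa>) * (star (w \<nu>) * w \<kappa>)"
      by (simp add: monom_def star_simps mult.assoc)
    then show ?thesis
      using assms \<kappa> len word_isometry[of "drop (length \<mu>) \<kappa>"]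
      by (auto simp: star_word_mult_word_le words_of_iff star_zero)
  qed
  then have "(\<Sum>\<kappa>\<in>words_of n N. star (w \<kappa>) * monom \<mu> \<nu> * w \<kappa>)
      = (\<Sum>\<kappa>\<in>words_of n N. if \<kappa> \<in> ?A \<and> \<mu> = \<nu> then 1 else 0)"
    by (intro sum.cong refl)
  also have "\<dots> = of_real (if \<mu> = \<nu> then n ^ (N - length \<mu>) else 0)"
    using card_words_of_prefix[OF \<mu>] by (auto simp: sum.If_cases Int_def)
  finally have "kms N (monom \<mu> \<nu>) = (1 / n ^ N) *\<^sub>R of_real (if \<mu> = \<nu> then n ^ (N - length \<mu>) else 0)"
    using assms len by (simp add: kms_def core_part_monom)
  also have "\<dots> = of_real ((1 / n ^ N) * (if \<mu> = \<nu> then n ^ (N - length \<mu>) else 0))"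
    unfolding scaleR_conv_of_real of_real_mult[symmetric] ..
  also have "(1 / n ^ N) * real (if \<mu> = \<nu> then n ^ (N - length \<mu>) else 0)
      = (if \<mu> = \<nu> then 1 / n ^ length \<mu> else 0)"
    using \<mu> n_ge_2 by (auto simp: power_diff)
  finally show ?thesis .
qed

text \<open>The filtration belonging to the gauge grading, in which every generator has degree 1;
  the bounds add under multiplication.\<close>

definition filt :: "int \<Rightarrow> 'a set" where
  "filt d = complex_vs.span
     {monom \<mu> \<nu> | \<mu> \<nu>. \<mu> \<in> words n \<and> \<nu> \<in> words n \<and> int (length \<mu>) - int (length \<nu>) \<le> d}"

lemma filt_induct [consumes 1, case_names monom zero add scale]:
  assumes "x \<in> filt d"
    and "\<And>\<mu> \<nu>. \<mu> \<in> words n \<Longrightarrow> \<nu> \<in> words n \<Longrightarrow> int (length \<mu>) - int (length \<nu>) \<le> d \<Longrightarrow> P (monom \<mu> \<nu>)"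
    and "P 0" "\<And>x y. P x \<Longrightarrow> P y \<Longrightarrow> P (x + y)" "\<And>c x. P x \<Longrightarrow> P (c *\<^sub>C x)"
  shows "P x"
  using assms(1) unfolding filt_def
  by (rule complex_vs.span_induct) (auto simp: complex_vs.subspace_def intro: assms)

lemma monom_in_filt:
  "\<mu> \<in> words n \<Longrightarrow> \<nu> \<in> words n \<Longrightarrow> int (length \<mu>) - int (length \<nu>) \<le> d \<Longrightarrow> monom \<mu> \<nu> \<in> filt d"
  unfolding filt_def by (rule complex_vs.span_base) blast

lemma subspace_filt [simp]: "complex_vs.subspace (filt d)"
  by (simp add: filt_def)

lemma filt_0: "0 \<in> filt d"
  by (simp add: filt_def complex_vs.span_zero)

lemma filt_mult:
  assumes x: "x \<in> filt d" and y: "y \<in> filt e"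
  shows "x * y \<in> filt (d + e)"
  using x
proof (induction rule: filt_induct)
  case (monom \<mu> \<nu>)
  show ?case using y
  proof (induction rule: filt_induct)
    case m: (monom \<alpha> \<beta>)
    note a = monom m
    show ?case
    proof (cases "length \<nu> \<le> length \<alpha>")
      case True
      then show ?thesis using a by (auto simp: monom_mult_le filt_0 intro!: monom_in_filt)
    next
      case False
      then show ?thesis using a by (auto simp: monom_mult_ge filt_0 intro!: monom_in_filt)
    qed
  qed (auto simp: filt_0 distrib_left scaleC_mult_right complex_vs.subspace_add complex_vs.subspace_scale)
qed (auto simp: filt_0 distrib_right scaleC_mult_left complex_vs.subspace_add complex_vs.subspace_scale)

text \<open>With second words of one common length, distinct pairs give monomials that are
  orthogonal for the KMS state in both orders of multiplication.\<close>

definition negative_words :: "nat \<Rightarrow> (nat list \<times> nat list) set" where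
  "negative_words M = (\<Union>k<M. words_of n k) \<times> words_of n M"

text \<open>Common suffixes bring all second words to one length, and the first words stay strictly
  shorter.\<close>

lemma filt_negative_expand:
  assumes "x \<in> filt (- 1)"
  obtains M c where "x = (\<Sum>p\<in>negative_words M. c p *\<^sub>C monom (fst p) (snd p))"
proof -
  let ?f = "\<lambda>p. monom (fst p) (snd p)"
  define V where "V M = complex_vs.span (?f ` negative_words M)" for M
  have monom_V: "monom \<mu> \<nu> \<in> V M"
    if a: "\<mu> \<in> words n" "\<nu> \<in> words n" "length \<mu> < length \<nu>" "length \<nu> \<le> M" for \<mu> \<nu> M
  proof -
    have "monom (\<mu> @ \<kappa>) (\<nu> @ \<kappa>) \<in> V M" if "\<kappa> \<in> words_of n (M - length \<nu>)" for \<kappa>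
      unfolding V_def using a that
      by (intro complex_vs.span_base image_eqI[of _ _ "(\<mu> @ \<kappa>, \<nu> @ \<kappa>)"])
        (auto simp: negative_words_def words_of_iff)
    then show ?thesis
      unfolding V_def by (subst monom_expand[of _ _ "M - length \<nu>"]) (auto intro: complex_vs.span_sum)
  qed
  have V_mono: "V M \<subseteq> V N" if "M \<le> N" for M N
    unfolding V_def
  proof (rule complex_vs.span_minimal)
    show "?f ` negative_words M \<subseteq> complex_vs.span (?f ` negative_words N)"
      using monom_V[of _ _ N] that by (auto simp: negative_words_def words_of_iff V_def)
  qed simp
  have "\<exists>M. x \<in> V M"
    using assms
  proof (induction rule: filt_induct)
    case (monom \<mu> \<nu>)
    then show ?case using monom_V[of \<mu> \<nu> "length \<nu>"] by auto
  next
    case (add x y)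
    then obtain M N where "x \<in> V M" "y \<in> V N" by blast
    then have "x \<in> V (max M N)" "y \<in> V (max M N)"
      using V_mono[of M "max M N"] V_mono[of N "max M N"] by auto
    then show ?case unfolding V_def using complex_vs.span_add by blast
  qed (auto simp: V_def complex_vs.span_zero intro: complex_vs.span_scale)
  then obtain M where M: "x \<in> V M" by blast
  have "finite (negative_words M)" by (simp add: negative_words_def)
  obtain c where "x = (\<Sum>p\<in>negative_words M. c p *\<^sub>C ?f p)"
    using span_image_finite[OF \<open>finite (negative_words M)\<close> M[unfolded V_def]] .
  then show thesis by (rule that)
qed

text \<open>For a homogeneous \<open>x\<close> of degree \<open>-k\<close> the KMS condition reads
  \<open>kms (star x * x) = n\<^sup>-\<^sup>k kms (x * star x)\<close>.\<close>

lemma kms_negative: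
  assumes "x \<in> filt (- 1)"
  obtains N and a b :: real where "kms N (x * star x) = of_real a" "kms N (star x * x) = of_real b" "n * b \<le> a"
proof -
  obtain M c where x: "x = (\<Sum>p\<in>negative_words M. c p *\<^sub>C monom (fst p) (snd p))"
    using filt_negative_expand[OF assms] .
  let ?F = "negative_words M" and ?f = "\<lambda>p. monom (fst p) (snd p)"
  have fin: "finite ?F" by (simp add: negative_words_def)
  have F: "fst p \<in> words n \<and> length (fst p) < M \<and> snd p \<in> words n \<and> length (snd p) = M" if "p \<in> ?F" for p
    using that by (auto simp: negative_words_def words_of_iff)
  have right: "kms (2 * M) (?f p * star (?f q)) = of_real (if p = q then 1 / n ^ length (fst p) else 0)"
    if "p \<in> ?F" "q \<in> ?F" for p q
    using F[OF that(1)] F[OF that(2)]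
    by (auto simp: star_monom monom_mult_le kms_monom kms_linear prod_eq_iff)
  \<comment> \<open>If the first words differ in length, the product is 0 or a monomial with words
    of different lengths, on which the state vanishes. Its words are shorter than 2 M, which
    explains the level.\<close>
  have left: "kms (2 * M) (star (?f p) * ?f q) = of_real (if p = q then 1 / n ^ M else 0)"
    if p: "p \<in> ?F" and q: "q \<in> ?F" for p q
  proof (cases "length (fst p) \<le> length (fst q)")
    case True
    show ?thesis
    proof (cases "length (fst p) = length (fst q)")
      case True
      then have "star (?f p) * ?f q = (if fst p = fst q then monom (snd p) (snd q) else 0)"
        using F[OF p] F[OF q] monom_mult_le[of "fst p" "fst q" "snd p" "snd q"]
        by (simp add: star_monom eq_commute[of "fst q"])
      moreover have "kms (2 * M) (monom (snd p) (snd q)) = of_real (if snd p = snd q then 1 / n ^ M else 0)"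
        using F[OF p] F[OF q] kms_monom[of "snd p" "2 * M" "snd q"] by simp
      ultimately show ?thesis
        by (cases "fst p = fst q"; cases "snd p = snd q"; simp add: prod_eq_iff kms_linear)
    next
      case False
      then have "length (snd p @ drop (length (fst p)) (fst q)) \<noteq> length (snd q)"
        using True F[OF p] F[OF q] by simp
      then have ne: "snd p @ drop (length (fst p)) (fst q) \<noteq> snd q" by metis
      have "kms (2 * M) (monom (snd p @ drop (length (fst p)) (fst q)) (snd q)) = 0"
        using F[OF p] F[OF q] ne by (subst kms_monom) auto
      moreover have "p \<noteq> q" using False by auto
      ultimately show ?thesis using True F[OF p] F[OF q]
        by (simp add: star_monom monom_mult_le kms_linear)
    qed
  next
    case False
    then have "length (snd q @ drop (length (fst q)) (fst p)) \<noteq> length (snd p)"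
      using F[OF p] F[OF q] by simp
    then have ne: "snd p \<noteq> snd q @ drop (length (fst q)) (fst p)" by metis
    have "kms (2 * M) (monom (snd p) (snd q @ drop (length (fst q)) (fst p))) = 0"
      using F[OF p] F[OF q] ne by (subst kms_monom) auto
    moreover have "p \<noteq> q" using False by auto
    ultimately show ?thesis using False F[OF p] F[OF q]
      by (simp add: star_monom monom_mult_ge kms_linear)
  qed
  have of_real_C: "complex_of_real s *\<^sub>C (of_real r :: 'a) = of_real (s * r)" for s r
    by (simp add: scaleC_of_real scaleR_conv_of_real)
  have diag: "(\<Sum>p\<in>?F. \<Sum>q\<in>?F. (c p * cnj (c q)) *\<^sub>C of_real (if p = q then r p else 0)) =
      (of_real (\<Sum>p\<in>?F. (cmod (c p))\<^sup>2 * r p) :: 'a)" for r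
  proof -
    have "(\<Sum>q\<in>?F. (c p * cnj (c q)) *\<^sub>C of_real (if p = q then r p else 0)) =
        (of_real ((cmod (c p))\<^sup>2 * r p) :: 'a)" if "p \<in> ?F" for p
    proof -
      have "(\<Sum>q\<in>?F. (c p * cnj (c q)) *\<^sub>C (of_real (if p = q then r p else 0) :: 'a)) =
          (\<Sum>q\<in>?F. if p = q then (c p * cnj (c q)) *\<^sub>C of_real (r p) else 0)"
        by (intro sum.cong) auto
      also have "\<dots> = (c p * cnj (c p)) *\<^sub>C of_real (r p)" using that fin by simp
      also have "\<dots> = of_real ((cmod (c p))\<^sup>2 * r p)"
        unfolding complex_norm_square[symmetric] by (rule of_real_C)
      finally show ?thesis .
    qed
    then show ?thesis by simp
  qed
  let ?a = "\<Sum>p\<in>?F. (cmod (c p))\<^sup>2 * (1 / n ^ length (fst p))" and ?b = "\<Sum>p\<in>?F. (cmod (c p))\<^sup>2 * (1 / n ^ M)"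
  have "kms (2 * M) (x * star x) = (\<Sum>p\<in>?F. \<Sum>q\<in>?F. (c p * cnj (c q)) *\<^sub>C kms (2 * M) (?f p * star (?f q)))"
    by (simp add: x star_simps sum_product kms_sum scaleC_mult_left scaleC_mult_right scaleC_scaleC kms_linear mult.commute)
  also have "\<dots> = of_real ?a"
    unfolding diag[symmetric] by (intro sum.cong refl) (simp add: right)
  finally have 1: "kms (2 * M) (x * star x) = of_real ?a" .
  have "kms (2 * M) (star x * x) = (\<Sum>q\<in>?F. \<Sum>p\<in>?F. (c p * cnj (c q)) *\<^sub>C kms (2 * M) (star (?f q) * ?f p))"
    by (simp add: x star_simps sum_product kms_sum scaleC_mult_left scaleC_mult_right scaleC_scaleC kms_linear mult.commute)
  also have "\<dots> = (\<Sum>p\<in>?F. \<Sum>q\<in>?F. (c p * cnj (c q)) *\<^sub>C kms (2 * M) (star (?f q) * ?f p))"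
    by (rule sum.swap)
  also have "\<dots> = of_real ?b"
    unfolding diag[symmetric] by (intro sum.cong refl) (simp add: left)
  finally have 2: "kms (2 * M) (star x * x) = of_real ?b" .
  \<comment> \<open>The factor \<open>n\<close> is gained because the first word is at least one
    letter shorter than \<open>M\<close>.\<close>
  have "n * (1 / n ^ M) \<le> 1 / real n ^ length (fst p)" if "p \<in> ?F" for p
  proof -
    have "real n * n ^ length (fst p) \<le> n ^ M"
      using F[OF that] n_ge_2 power_increasing[of "Suc (length (fst p))" M "real n"] by simp
    then show ?thesis using n_ge_2 by (simp add: field_simps)
  qed
  then have "(cmod (c p))\<^sup>2 * (n * (1 / n ^ M)) \<le> (cmod (c p))\<^sup>2 * (1 / n ^ length (fst p))" if "p \<in> ?F" for p
    using that by (intro mult_left_mono) auto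
  then have "n * ?b \<le> ?a"
    unfolding sum_distrib_left by (intro sum_mono) (simp add: mult.commute)
  then show thesis using that 1 2 by blast
qed

lemma kms_1: "kms N 1 = 1"
  using kms_monom[of "[]" N "[]"] by (simp add: monom_def star_one)

text \<open>If \<open>x\<close> in \<open>filt (- 1)\<close> were within 1/8 of \<open>u\<close>,
  then \<open>star x * x\<close> and \<open>x * star x\<close> would be within 9/64 + 1/8 < 1/3 of
  1. The values from \<open>kms_negative\<close> would satisfy a < 4/3 and b > 2/3, against 2 b
  \<le> n b \<le> a.\<close>

lemma unitary_far_from_negative:
  assumes u: "u \<in> unitaries" and x: "x \<in> closure (filt (- 1))"
  shows "norm (u - x) \<ge> 1 / 8"
proof -
  have *: "norm (u - x) \<ge> 1 / 8" if x: "x \<in> filt (- 1)" for x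
  proof (rule ccontr)
    assume less: "\<not> norm (u - x) \<ge> 1 / 8"
    have nu: "norm u = 1" and uu: "star u * u = 1" "u * star u = 1"
      using u norm_isometry by (auto simp: unitaries_def)
    have nx: "norm x \<le> 9 / 8"
      using less norm_triangle_ineq4[of u "u - x"] nu by simp
    have close: "norm (star y * y - 1) < 1 / 3"
      if v: "star v * v = 1" "norm v = 1" "norm (v - y) < 1 / 8" "norm y \<le> 9 / 8" for v y :: 'a
    proof -
      have "star y * y - 1 = - (star (v - y) * y) - star v * (v - y)"
        using v by (simp add: star_simps algebra_simps)
      then have "norm (star y * y - 1) \<le> norm (star (v - y) * y) + norm (star v * (v - y))"
        using norm_triangle_ineq4[of "- (star (v - y) * y)" "star v * (v - y)"] by simp
      also have "\<dots> \<le> norm (v - y) * norm y + norm v * norm (v - y)"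
        using norm_mult_ineq[of "star (v - y)" y] norm_mult_ineq[of "star v" "v - y"] by (simp add: norm_star)
      also have "\<dots> \<le> (1 / 8) * (9 / 8) + 1 * (1 / 8)"
        using v by (intro add_mono mult_mono) auto
      finally show ?thesis by simp
    qed
    have c1: "norm (star x * x - 1) < 1 / 3"
      using close[of u x] less nu uu nx by simp
    have c2: "norm (x * star x - 1) < 1 / 3"
      using close[of "star u" "star x"] less nu uu nx by (simp add: norm_star star_star flip: star_diff)
    obtain N and a b :: real where N: "kms N (x * star x) = of_real a" "kms N (star x * x) = of_real b" "n * b \<le> a"
      using kms_negative[OF x] .
    have bound: "\<bar>r - 1\<bar> < 1 / 3" if "kms N y = of_real r" "norm (y - 1) < 1 / 3" for y r
    proof -
      have "kms N (y - 1) = of_real (r - 1)" using that by (simp add: kms_linear kms_1)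
      then have "\<bar>r - 1\<bar> \<le> norm (y - 1)"
        using norm_kms[of N "y - 1"] by (simp only: norm_of_real)
      then show ?thesis using that by linarith
    qed
    have a: "\<bar>a - 1\<bar> < 1 / 3" using bound[OF N(1) c2] .
    have b: "\<bar>b - 1\<bar> < 1 / 3" using bound[OF N(2) c1] .
    have "2 * b \<le> n * b" using n_ge_2 b by (intro mult_right_mono) linarith+
    then show False using N(3) a b by linarith
  qed
  have "closed {x. norm (u - x) \<ge> 1 / 8}"
    by (intro closed_Collect_le continuous_intros)
  then have "closure (filt (- 1)) \<subseteq> {x. norm (u - x) \<ge> 1 / 8}"
    by (rule closure_minimal[rotated]) (use * in blast)
  then show ?thesis using x by blast
qed

end

section \<open>The automorphism\<close>

definition monomial_sums :: "nat \<Rightarrow> (nat \<Rightarrow> 'a::cstar_algebra) \<Rightarrow> 'a set" where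
  "monomial_sums n S = {x. \<exists>ps. set ps \<subseteq> words n \<times> words n \<and>
     x = (\<Sum>(\<alpha>, \<beta>)\<leftarrow>ps. word_elem S \<alpha> * star (word_elem S \<beta>))}"

lemma monomial_sums_monom:
  assumes "\<alpha> \<in> words n" "\<beta> \<in> words n"
  shows "word_elem S \<alpha> * star (word_elem S \<beta>) \<in> monomial_sums n S"
  unfolding monomial_sums_def using assms by (auto intro!: exI[of _ "[(\<alpha>, \<beta>)]"])

lemma monomial_sums_add:
  assumes "x \<in> monomial_sums n S" "y \<in> monomial_sums n S"
  shows "x + y \<in> monomial_sums n S"
proof -
  obtain ps qs where "set ps \<subseteq> words n \<times> words n" "x = (\<Sum>(\<alpha>, \<beta>)\<leftarrow>ps. word_elem S \<alpha> * star (word_elem S \<beta>))"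
    "set qs \<subseteq> words n \<times> words n" "y = (\<Sum>(\<alpha>, \<beta>)\<leftarrow>qs. word_elem S \<alpha> * star (word_elem S \<beta>))"
    using assms unfolding monomial_sums_def by auto
  then show ?thesis unfolding monomial_sums_def by (auto intro!: exI[of _ "ps @ qs"])
qed

lemma monomial_sums_sum:
  assumes "\<And>i. i \<in> I \<Longrightarrow> f i \<in> monomial_sums n S"
  shows "(\<Sum>i\<in>I. f i) \<in> monomial_sums n S"
proof -
  have "0 \<in> monomial_sums n S" unfolding monomial_sums_def by (auto intro!: exI[of _ "[]"])
  then show ?thesis using assms
    by (induction I rule: infinite_finite_induct) (auto intro: monomial_sums_add)
qed

lemma monomial_sums_sandwich:
  assumes "\<mu> \<in> words n" "\<nu> \<in> words n" "x \<in> monomial_sums n S"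
  shows "word_elem S \<mu> * x * star (word_elem S \<nu>) \<in> monomial_sums n S"
proof -
  obtain ps where ps: "set ps \<subseteq> words n \<times> words n"
    and x: "x = (\<Sum>(\<alpha>, \<beta>)\<leftarrow>ps. word_elem S \<alpha> * star (word_elem S \<beta>))"
    using assms(3) unfolding monomial_sums_def by auto
  have "word_elem S \<mu> * x * star (word_elem S \<nu>) =
      (\<Sum>(\<alpha>, \<beta>)\<leftarrow>map (\<lambda>(\<alpha>, \<beta>). (\<mu> @ \<alpha>, \<nu> @ \<beta>)) ps. word_elem S \<alpha> * star (word_elem S \<beta>))"
    unfolding x by (induction ps) (auto simp: word_elem_append star_simps algebra_simps)
  moreover have "set (map (\<lambda>(\<alpha>, \<beta>). (\<mu> @ \<alpha>, \<nu> @ \<beta>)) ps) \<subseteq> words n \<times> words n"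
    using ps assms by auto
  ultimately show ?thesis unfolding monomial_sums_def by blast
qed

section \<open>The prefix exchange and the endomorphism it defines\<close>

context cuntz_algebra
begin

text \<open>As prefix replacement maps, \<open>swap\<close> exchanges 2 and 12, and \<open>twist\<close> does so after an initial
  letter 2.\<close>

definition swap :: 'a where
  "swap = S 1 * S 2 * star (S 2) + S 2 * star (S 2) * star (S 1) +
     (1 - S 2 * star (S 2) - S 1 * S 2 * star (S 2) * star (S 1))"

definition twist :: 'a where
  "twist = 1 - S 2 * star (S 2) + S 2 * swap * star (S 2)"

lemma gens12:
  "star (S 1) * S 1 = 1" "star (S 2) * S 2 = 1" "star (S 1) * S 2 = 0" "star (S 2) * S 1 = 0"
  "star (S 1) * (S 1 * x) = x" "star (S 2) * (S 2 * x) = x"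
  "star (S 1) * (S 2 * x) = 0" "star (S 2) * (S 1 * x) = 0"
proof -
  have "1 \<in> {1..n}" "2 \<in> {1..n}" using n_ge_2 by auto
  then show *: "star (S 1) * S 1 = 1" "star (S 2) * S 2 = 1" "star (S 1) * S 2 = 0" "star (S 2) * S 1 = 0"
    using star_mult_gen[of 1 1] star_mult_gen[of 2 2] star_mult_gen[of 1 2] star_mult_gen[of 2 1] by auto
  show "star (S 1) * (S 1 * x) = x" "star (S 2) * (S 2 * x) = x"
    "star (S 1) * (S 2 * x) = 0" "star (S 2) * (S 1 * x) = 0"
    by (simp_all only: * mult.assoc[symmetric] mult_1_left mult_zero_left)
qed

lemma star_swap: "star swap = swap"
  by (simp add: swap_def star_simps mult.assoc)

lemma swap_swap: "swap * swap = 1"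
  by (simp add: swap_def algebra_simps gens12 del: One_nat_def)

lemma swap_gen2: "swap * S 2 = S 1 * S 2"
  by (simp add: swap_def algebra_simps gens12 del: One_nat_def)

lemma twist_unitary: "twist \<in> unitaries"
proof -
  have "star twist = twist"
    by (simp add: twist_def star_simps star_swap mult.assoc)
  moreover have "swap * (swap * x) = x" for x
    by (simp add: swap_swap flip: mult.assoc)
  then have "twist * twist = 1"
    by (simp add: twist_def algebra_simps gens12 del: One_nat_def)
  ultimately show ?thesis by (simp add: unitaries_def)
qed

lemma twist_gen:
  assumes "i \<in> {1..n}"
  shows "twist * S i = (if i = 2 then S 2 * swap else S i)"
proof (cases "i = 2")
  case True
  then show ?thesis by (simp add: twist_def algebra_simps gens12)
next
  case False
  then have "star (S 2) * S i = 0" using star_mult_gen[of 2 i] assms n_ge_2 by simp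
  then show ?thesis using False by (simp add: twist_def algebra_simps)
qed

text \<open>Only sums without negative coefficients are available, so complements of projections
  have to be resolved into monomials: the complement of the range of \<open>S 2\<close> into the
  other ranges, and the last term of \<open>swap\<close> into the prefixes other than 1 and 2
  together with the prefixes 1 i for i \<noteq> 2.\<close>

lemma twist_sum: "twist \<in> monomial_sums n S"
proof -
  have word1: "monom [i] [j] \<in> monomial_sums n S" if "i \<in> {1..n}" "j \<in> {1..n}" for i j
    unfolding monom_def using that by (intro monomial_sums_monom) auto
  have sand: "S i * x * star (S j) \<in> monomial_sums n S"
    if "i \<in> {1..n}" "j \<in> {1..n}" "x \<in> monomial_sums n S" for i j x
    using monomial_sums_sandwich[of "[i]" n "[j]" x S] that by (simp add: word_elem_Cons)
  have 12: "1 \<in> {1..n}" "2 \<in> {1..n}" using n_ge_2 by auto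
  have ranges: "S i * star (S i) = monom [i] [i]" for i by (simp add: monom_def word_elem_Cons)
  have not2: "1 - S 2 * star (S 2) = (\<Sum>i\<in>{1..n} - {2}. monom [i] [i])"
    using sum_ranges sum.remove[of "{1..n}" 2 "\<lambda>i. S i * star (S i)"] 12
    by (simp add: ranges diff_eq_eq add.commute del: One_nat_def)
  have "1 - S 2 * star (S 2) - S 1 * star (S 1) = (\<Sum>i\<in>{1..n} - {2} - {1}. monom [i] [i])"
    unfolding not2 using sum.remove[of "{1..n} - {2}" 1 "\<lambda>i. monom [i] [i]"] 12
    by (simp add: ranges del: One_nat_def)
  moreover have "1 - S 2 * star (S 2) - S 1 * S 2 * star (S 2) * star (S 1) =
      (1 - S 2 * star (S 2) - S 1 * star (S 1)) + S 1 * (1 - S 2 * star (S 2)) * star (S 1)"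
    by (simp add: algebra_simps)
  ultimately have "1 - S 2 * star (S 2) - S 1 * S 2 * star (S 2) * star (S 1) =
      (\<Sum>i\<in>{1..n} - {2} - {1}. monom [i] [i]) + S 1 * (\<Sum>i\<in>{1..n} - {2}. monom [i] [i]) * star (S 1)"
    using not2 by simp
  moreover have "S 1 * S 2 * star (S 2) = word_elem S [1, 2] * star (word_elem S [2])"
    "S 2 * star (S 2) * star (S 1) = word_elem S [2] * star (word_elem S [1, 2])"
    by (simp_all add: word_elem_Cons star_simps mult.assoc)
  ultimately have "swap \<in> monomial_sums n S"
    unfolding swap_def using 12
    by (auto intro!: monomial_sums_add monomial_sums_sum sand word1 monomial_sums_monom simp del: One_nat_def)
  then show ?thesis
    unfolding twist_def not2 using 12
    by (intro monomial_sums_add monomial_sums_sum sand word1) auto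
qed

text \<open>As \<open>twist\<close> is unitary, the elements \<open>twist * S i\<close> form a Cuntz
  family again and \<open>universal\<close> applies. Being an involution is a closed condition, so
  it suffices to check it on the generators.\<close>

lemma twist_endo:
  obtains \<phi> where "is_cuntz_endo n S twist \<phi>" "bij \<phi>"
proof -
  have tt: "star twist * twist = 1" "twist * star twist = 1"
    using twist_unitary by (auto simp: unitaries_def)
  have "cuntz_family n (\<lambda>i. twist * S i)"
  proof
    show "star (twist * S i) * (twist * S i) = 1" if "i \<in> {1..n}" for i
      using isometry[OF that] tt by (simp add: star_simps) (metis mult.assoc mult.left_neutral)
    have "(\<Sum>i=1..n. twist * S i * star (twist * S i)) = twist * (\<Sum>i=1..n. S i * star (S i)) * star twist"
      by (simp add: star_simps sum_distrib_left sum_distrib_right mult.assoc)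
    then show "(\<Sum>i=1..n. twist * S i * star (twist * S i)) = 1"
      unfolding sum_ranges using tt by simp
  qed (rule n_ge_2)
  then obtain \<phi> where endo: "unital_star_endo \<phi>" and cont: "continuous_on UNIV \<phi>"
    and \<phi>: "\<And>i. i \<in> {1..n} \<Longrightarrow> \<phi> (S i) = twist * S i"
    using universal by blast
  have hom: "\<phi> (x + y) = \<phi> x + \<phi> y" "\<phi> (c *\<^sub>C x) = c *\<^sub>C \<phi> x" "\<phi> (x * y) = \<phi> x * \<phi> y"
    "\<phi> (star x) = star (\<phi> x)" "\<phi> 1 = 1" for x y c
    using endo by (auto simp: unital_star_endo_def)
  have diff: "\<phi> (x - y) = \<phi> x - \<phi> y" for x y
    using hom(1)[of "x - y" y] by (simp add: algebra_simps)
  have gen: "\<phi> (S i) = (if i = 2 then S 2 * swap else S i)" if "i \<in> {1..n}" for i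
    using \<phi>[OF that] twist_gen[OF that] by simp
  have gen12: "\<phi> (S 1) = S 1" "\<phi> (S 2) = S 2 * swap"
    using gen[of 1] gen[of 2] n_ge_2 by auto
  have ss: "swap * (swap * x) = x" for x
    by (simp add: swap_swap flip: mult.assoc)
  \<comment> \<open>In every term of \<open>swap\<close> the generator \<open>S 2\<close> occurs
    only within \<open>S 2 * star (S 2)\<close>, where the two new factors \<open>swap\<close>
    cancel.\<close>
  have "\<phi> swap = swap"
    unfolding swap_def[unfolded mult.assoc]
    by (simp add: hom diff gen12 star_simps star_swap mult.assoc ss del: One_nat_def)
  then have "\<phi> (\<phi> (S i)) = S i" if "i \<in> {1..n}" for i
    using that by (simp add: gen hom mult.assoc swap_swap)
  then have "S ` {1..n} \<subseteq> {x. \<phi> (\<phi> x) = x}" by blast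
  moreover have "cstar_subalgebra {x. \<phi> (\<phi> x) = x}"
    unfolding cstar_subalgebra_def complex_vs.subspace_def
  proof (intro conjI)
    show "closed {x. \<phi> (\<phi> x) = x}"
      by (intro closed_Collect_eq continuous_on_id continuous_on_compose2[OF cont cont]) auto
    show "0 \<in> {x. \<phi> (\<phi> x) = x}" using diff[of 0 0] by simp
  qed (auto simp: hom)
  ultimately have "\<phi> (\<phi> x) = x" for x
    using generated_induct[of "{x. \<phi> (\<phi> x) = x}" x] by auto
  then have "bij \<phi>" by (rule involuntory_imp_bij)
  then show thesis
    using that[of \<phi>] endo \<phi> by (simp add: is_cuntz_endo_def)
qed

text \<open>Every \<open>swap\<close> followed by an \<open>S 2\<close> is absorbed into a letter 1,
  so the word is 2 followed by \<open>k\<close> copies of 12, and only the last \<open>swap\<close>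
  survives. Each further factor adds two letters, twice the degree gained by a factor
  \<open>v * S 2\<close>.\<close>

lemma power_gen2_swap:
  "\<exists>\<alpha> \<in> words n. length \<alpha> = 2 * k + 1 \<and> (S 2 * swap) ^ (k + 1) = w \<alpha> * swap"
proof (induction k)
  case 0
  then show ?case using n_ge_2 by (intro bexI[of _ "[2]"]) (auto simp: word_elem_Cons)
next
  case (Suc k)
  then obtain \<alpha> where \<alpha>: "\<alpha> \<in> words n" "length \<alpha> = 2 * k + 1" "(S 2 * swap) ^ (k + 1) = w \<alpha> * swap"
    by blast
  have "(S 2 * swap) ^ (Suc k + 1) = (w \<alpha> * swap) * (S 2 * swap)"
    using \<alpha>(3) by (simp only: add_Suc power_Suc2)
  also have "\<dots> = w \<alpha> * (swap * S 2) * swap" by (simp add: mult.assoc)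
  also have "\<dots> = w (\<alpha> @ [1, 2]) * swap"
    by (simp add: swap_gen2 word_elem_append word_elem_Cons mult.assoc)
  finally show ?case using \<alpha> n_ge_2 by (intro bexI[of _ "\<alpha> @ [1, 2]"]) auto
qed

lemma core_subset_filt: "cuntz_core n S \<subseteq> closure (filt 0)"
  unfolding cuntz_core_def filt_def
  by (intro closure_mono complex_vs.span_mono) (fastforce simp: monom_def)

lemma level_subset_filt: "level N \<subseteq> filt (int N)"
  unfolding level_def filt_def by (rule complex_vs.span_mono) fastforce

lemma twist_endo_not_core:
  assumes \<phi>: "is_cuntz_endo n S twist \<phi>" and z: "z \<in> unitaries"
    and v: "v \<in> unitaries" "v \<in> cuntz_core n S" and \<psi>: "is_cuntz_endo n S v \<psi>"
  shows "\<phi> \<noteq> Ad z \<circ> \<psi>"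
proof
  assume eq: "\<phi> = Ad z \<circ> \<psi>"
  have 2: "2 \<in> {1..n}" using n_ge_2 by simp
  have zz: "star z * z = 1" "z * star z = 1" using z by (auto simp: unitaries_def)
  \<comment> \<open>The tolerance is the distance in \<open>unitary_far_from_negative\<close>; the
    polynomial \<open>z0\<close> has a finite degree bound.\<close>
  obtain z0 where z0: "z0 \<in> (\<Union>N. level N)" "dist z0 z < 1 / 8"
    using closure_Union_level closure_approachable[of z "\<Union>N. level N"]
    by (metis UNIV_I zero_less_divide_1_iff zero_less_numeral)
  then obtain N where N: "z0 \<in> filt (int N)" using level_subset_filt by blast
  \<comment> \<open>The degree bounds of \<open>star (w \<alpha>)\<close>, \<open>z0\<close> and
    \<open>?y\<close> add up to -(2 k + 1) + N + (k + 1) = N - k, and this choice makes it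
    -1.\<close>
  define k where "k = N + 1"
  obtain \<alpha> where \<alpha>: "\<alpha> \<in> words n" "length \<alpha> = 2 * k + 1" "(S 2 * swap) ^ (k + 1) = w \<alpha> * swap"
    using power_gen2_swap by blast
  let ?y = "(v * S 2) ^ (k + 1)"
  have hom_power: "h (x ^ j) = h x ^ j" if "unital_star_endo h" for h :: "'a \<Rightarrow> 'a" and x j
    using that by (induction j) (auto simp: unital_star_endo_def)
  have "\<phi> (S 2 ^ (k + 1)) = w \<alpha> * swap"
    using \<phi> 2 \<alpha>(3) twist_gen[OF 2] hom_power[of \<phi> "S 2" "k + 1"]
    unfolding is_cuntz_endo_def by metis
  moreover have "\<phi> (S 2 ^ (k + 1)) = z * ?y * star z"
    using \<psi> 2 hom_power[of \<psi> "S 2" "k + 1"]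
    unfolding eq comp_def Ad_def is_cuntz_endo_def by metis
  ultimately have "w \<alpha> * swap * z = z * ?y"
    using zz by (simp add: mult.assoc)
  then have "star (w \<alpha>) * (w \<alpha> * swap * z) = star (w \<alpha>) * (z * ?y)" by simp
  then have X: "swap * z = star (w \<alpha>) * z * ?y"
    using word_isometry[OF \<alpha>(1)] by (simp flip: mult.assoc)
  have "star (swap * z) * (swap * z) = star z * (swap * swap) * z"
    "swap * z * star (swap * z) = swap * (z * star z) * swap"
    by (simp_all add: star_simps star_swap mult.assoc)
  then have "swap * z \<in> unitaries"
    using zz by (simp add: unitaries_def swap_swap)
  moreover have "star (w \<alpha>) * z0 * ?y \<in> closure (filt (- 1))"
  proof -
    have "monom [2] [] \<in> filt 1" using 2 by (intro monom_in_filt) auto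
    then have "S 2 \<in> closure (filt 1)"
      using closure_subset[of "filt 1"] by (auto simp: monom_def word_elem_Cons star_one)
    moreover have "v \<in> closure (filt 0)" using v core_subset_filt by blast
    ultimately have "v * S 2 \<in> closure (filt (0 + 1))"
      using closure_mult filt_mult by blast
    then have vS: "v * S 2 \<in> closure (filt 1)" by simp
    have y: "(v * S 2) ^ (j + 1) \<in> closure (filt (int j + 1))" for j
    proof (induction j)
      case (Suc j)
      have "(v * S 2) * (v * S 2) ^ (j + 1) \<in> closure (filt (1 + (int j + 1)))"
        by (rule closure_mult[OF vS Suc]) (rule filt_mult)
      then show ?case by (simp add: add.commute add.left_commute)
    qed (use vS in simp)
    have "monom [] \<alpha> \<in> filt (- (2 * int k + 1))" using \<alpha> by (intro monom_in_filt) auto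
    then have "star (w \<alpha>) * z0 \<in> filt (- (2 * int k + 1) + int N)"
      using N by (auto simp: monom_def intro: filt_mult)
    then have "star (w \<alpha>) * z0 \<in> closure (filt (- (2 * int k + 1) + int N))"
      using closure_subset by blast
    then have "star (w \<alpha>) * z0 * ?y \<in> closure (filt (- (2 * int k + 1) + int N + (int k + 1)))"
      by (rule closure_mult[OF _ y]) (rule filt_mult)
    moreover have "- (2 * int k + 1) + int N + (int k + 1) = - 1" by (simp add: k_def)
    ultimately show ?thesis by (simp only:)
  qed
  ultimately have "1 / 8 \<le> norm (swap * z - star (w \<alpha>) * z0 * ?y)"
    by (rule unitary_far_from_negative)
  \<comment> \<open>Both sides of \<open>z - z0\<close> are multiplied by contractions, so the
    distance stays below 1/8.\<close>
  also have "swap * z - star (w \<alpha>) * z0 * ?y = star (w \<alpha>) * (z - z0) * ?y"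
    unfolding X by (simp add: algebra_simps)
  also have "norm \<dots> \<le> norm (star (w \<alpha>)) * norm (z - z0) * norm ?y"
    by (meson mult_right_mono norm_ge_zero norm_mult_ineq order_trans)
  also have "\<dots> \<le> 1 * norm (z - z0) * 1"
  proof (intro mult_mono)
    show "norm (star (w \<alpha>)) \<le> 1" using norm_word[OF \<alpha>(1)] by (simp add: norm_star)
    have "star (v * S 2) * (v * S 2) = star (S 2) * (star v * v) * S 2"
      by (simp add: star_simps mult.assoc)
    then have "norm (v * S 2) = 1"
      using v isometry[OF 2] by (intro norm_isometry) (simp add: unitaries_def)
    then show "norm ?y \<le> 1" using norm_power_ineq[of "v * S 2" "k + 1"] by simp
  qed auto
  finally show False using z0 by (simp add: dist_norm norm_minus_commute)
qed

end

theorem theorem5p2: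
  fixes n :: nat and S :: "nat \<Rightarrow> 'a::cstar_algebra"
  assumes "n \<ge> 2" and "is_cuntz_algebra n S"
  shows "\<exists>u \<in> cuntz_sum_unitaries n S. \<exists>\<phi>.
           is_cuntz_endo n S u \<phi> \<and> bij \<phi> \<and>
           (\<forall>w \<in> unitaries. \<forall>v \<in> unitaries \<inter> cuntz_core n S. \<forall>\<psi>.
              is_cuntz_endo n S v \<psi> \<longrightarrow> \<phi> \<noteq> Ad w \<circ> \<psi>)"
proof -
  interpret cuntz_algebra n S
    using assms by unfold_locales (auto simp: is_cuntz_algebra_def)
  obtain \<phi> where "is_cuntz_endo n S twist \<phi>" "bij \<phi>" by (rule twist_endo)
  moreover have "twist \<in> cuntz_sum_unitaries n S"
    using twist_unitary twist_sum by (auto simp: cuntz_sum_unitaries_def monomial_sums_def)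
  ultimately show ?thesis using twist_endo_not_core by blast
qed

end
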